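(* Let $X$ be an $L_1$-predual space. Then being strongly proximinal is a transitive property for finite co-dimensional closed subspaces of $X$: if $Z\subset Y\subset X$ are closed subspaces of finite co-dimension in $X$, $Y$ is strongly proximinal in $X$ and $Z$ is strongly proximinal in $Y$, then $Z$ is strongly proximinal in $X$. Moreover, the intersection of finitely many strongly proximinal subspaces of $X$ of finite co-dimension is again a strongly proximinal subspace of $X$.
   Context: All Banach spaces are over $\mathbb{R}$ and all subspaces are closed. A Banach space $X$ is an $L_1$-predual space if $X^*$ is isometric to $L_1(\mu)$ for some positive measure $\mu$. For a subspace $Y$ of a Banach space $X$ and $x\in X$, let $P_Y(x)=\{y\in Y: d(x,Y)=\|x-y\|\}$. $Y$ is proximinal in $X$ if $P_Y(x)\neq\emptyset$ for all $x\notin Y$. A proximinal subspace $Y$ is strongly proximinal in $X$ if, for any $x\notin Y$ and any sequence $\{y_n\}_{n\ge 1}$ in $Y$ with $\lim_n\|x-y_n\|=d(x,Y)$, there are a subsequence $\{y_{n_k}\}$ and a sequence $\{z_k\}_{k\ge1}$ in $P_Y(x)$ such that $\|y_{n_k}-z_k\|\to 0$. *)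

theory Defs
  imports "HOL-Analysis.Analysis"
begin

text \<open>The points of \<open>L\<^sub>1(\<mu>)\<close>: integrable real functions modulo equality almost everywhere.\<close>

definition ae_eq_rel :: "'m measure \<Rightarrow> (('m \<Rightarrow> real) \<times> ('m \<Rightarrow> real)) set" where
  "ae_eq_rel M = {(f, g). integrable M f \<and> integrable M g \<and> (AE t in M. f t = g t)}"

definition L1_space :: "'m measure \<Rightarrow> ('m \<Rightarrow> real) set set" where
  "L1_space M = {f. integrable M f} // ae_eq_rel M"

text \<open>
  The dual of the Banach space \<open>'x\<close>, i.e. the type \<open>'x \<Rightarrow>\<^sub>L real\<close> with its operator norm, is linearly
  isometric to \<open>L\<^sub>1(M)\<close>. The vector space operations and the norm of \<open>L\<^sub>1(M)\<close> are computed on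
  arbitrary representatives. The measure is a parameter because HOL cannot quantify
  existentially over its type; in a premise, this is the same as ``for some measure''.
\<close>

definition L1_predual :: "'x::banach itself \<Rightarrow> 'm measure \<Rightarrow> bool" where
  "L1_predual _ M \<longleftrightarrow>
     (\<exists>T :: ('x \<Rightarrow>\<^sub>L real) \<Rightarrow> ('m \<Rightarrow> real) set.
        bij_betw T UNIV (L1_space M) \<and>
        (\<forall>\<phi> \<psi>. \<forall>f\<in>T \<phi>. \<forall>g\<in>T \<psi>. (\<lambda>t. f t + g t) \<in> T (\<phi> + \<psi>)) \<and>
        (\<forall>c \<phi>. \<forall>f\<in>T \<phi>. (\<lambda>t. c * f t) \<in> T (c *\<^sub>R \<phi>)) \<and>
        (\<forall>\<phi>. \<forall>f\<in>T \<phi>. norm \<phi> = (LINT t|M. \<bar>f t\<bar>)))"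

definition closed_subspace :: "'x::real_normed_vector set \<Rightarrow> bool" where
  "closed_subspace Y \<longleftrightarrow> subspace Y \<and> closed Y"

text \<open>\<open>'x / Y\<close> is finite dimensional: the cosets of some finite set \<open>B\<close> span the quotient.\<close>

definition finite_codim :: "'x::real_vector set \<Rightarrow> bool" where
  "finite_codim Y \<longleftrightarrow> (\<exists>B. finite B \<and> span (Y \<union> B) = UNIV)"

definition best_approx :: "'x::real_normed_vector set \<Rightarrow> 'x \<Rightarrow> 'x set" where
  "best_approx Y x = {y \<in> Y. infdist x Y = norm (x - y)}"

text \<open>Below, \<open>W\<close> is the ambient space, itself a closed subspace of the Banach space \<open>'x\<close>.\<close>

definition proximinal :: "'x::real_normed_vector set \<Rightarrow> 'x set \<Rightarrow> bool" where
  "proximinal Y W \<longleftrightarrow>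
     closed_subspace W \<and> closed_subspace Y \<and> Y \<subseteq> W \<and> (\<forall>x\<in>W - Y. best_approx Y x \<noteq> {})"

definition strongly_proximinal :: "'x::real_normed_vector set \<Rightarrow> 'x set \<Rightarrow> bool" where
  "strongly_proximinal Y W \<longleftrightarrow>
     proximinal Y W \<and>
     (\<forall>x\<in>W - Y. \<forall>y::nat \<Rightarrow> 'x.
        range y \<subseteq> Y \<and> (\<lambda>n. norm (x - y n)) \<longlonglongrightarrow> infdist x Y \<longrightarrow>
        (\<exists>(r::nat \<Rightarrow> nat) z. strict_mono r \<and> range z \<subseteq> best_approx Y x \<and>
           (\<lambda>k. norm (y (r k) - z k)) \<longlonglongrightarrow> 0))"

end

theory Submission
  imports Defs
begin

text \<open>
  Call a measurable set \<open>A\<close> finite if the functionals in \<open>X\<^sup>* = L\<^sub>1(M)\<close> that vanish off \<open>A\<close> span a finite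
  dimensional space \<open>V\<^sub>A\<close>, i.e. if \<open>A\<close> is essentially a finite union of atoms. Finite sets are closed
  under finite unions, so both claims follow once a closed subspace \<open>Z\<close> of finite codimension is
  strongly proximinal iff it contains the common kernel \<open>J\<^sub>A\<close> of some such \<open>V\<^sub>A\<close>, where for the
  forward direction it is enough that \<open>Z\<close> is strongly proximinal in some \<open>Y\<close> containing a \<open>J\<^sub>B\<close>.

  If \<open>J\<^sub>A \<subseteq> Z\<close>: since \<open>V\<^sub>A\<close> is an \<open>L\<close>-summand, \<open>J\<^sub>A\<close> is an \<open>M\<close>-ideal. A minimizing sequence in \<open>Z\<close>
  converges modulo \<open>J\<^sub>A\<close> along a subsequence, and the two ball property of \<open>M\<close>-ideals, iterated with
  geometrically decreasing errors, corrects it within \<open>J\<^sub>A\<close> to exact best approximations.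

  Conversely, strong proximinality of \<open>Z\<close> forces almost maximal points of a functional in \<open>Z\<^sup>\<bottom>\<close> to lie
  near its exposed face. For a functional that is not carried by a finite set this fails, as one sees
  by flipping its sign on a set of arbitrarily small positive mass.
\<close>

subsection \<open>The Hahn--Banach theorem\<close>

definition sublinear :: "('a::real_vector \<Rightarrow> real) \<Rightarrow> bool" where
  "sublinear p \<longleftrightarrow> p 0 = 0 \<and> (\<forall>x y. p (x + y) \<le> p x + p y) \<and> (\<forall>c x. c > 0 \<longrightarrow> p (c *\<^sub>R x) \<le> c * p x)"

lemma sublinear_zero: "sublinear p \<Longrightarrow> p 0 = 0"
  and sublinear_add: "sublinear p \<Longrightarrow> p (x + y) \<le> p x + p y"
  by (simp_all add: sublinear_def)

lemma sublinear_scaleR: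
  assumes "sublinear p" "c \<ge> 0"
  shows "p (c *\<^sub>R x) = c * p x"
proof (cases "c = 0")
  case False
  with assms have c: "c > 0" by simp
  have "p x = p ((1/c) *\<^sub>R (c *\<^sub>R x))" using c by simp
  also have "\<dots> \<le> (1/c) * p (c *\<^sub>R x)"
    using assms(1) c unfolding sublinear_def by (meson zero_less_divide_1_iff)
  finally have "c * p x \<le> p (c *\<^sub>R x)" using c by (simp add: field_simps)
  moreover have "p (c *\<^sub>R x) \<le> c * p x" using assms(1) c by (simp add: sublinear_def)
  ultimately show ?thesis by simp
qed (simp add: sublinear_zero[OF assms(1)])

lemma sublinear_minus: "sublinear p \<Longrightarrow> - p (- x) \<le> p x"
  using sublinear_add[of p x "-x"] sublinear_zero[of p] by simp

text \<open>For a subspace \<open>K\<close> and \<open>g = 0\<close> this is the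
  \<open>p\<close>-distance to \<open>K\<close>, the quotient seminorm when \<open>p\<close> is a
  norm. In general it packs an upper bound \<open>p\<close> and a lower bound \<open>g\<close> on
  \<open>K\<close> into one sublinear functional.\<close>

definition cone_inf :: "('a::real_vector \<Rightarrow> real) \<Rightarrow> 'a set \<Rightarrow> ('a \<Rightarrow> real) \<Rightarrow> 'a \<Rightarrow> real" where
  "cone_inf p K g x = (INF k\<in>K. p (x + k) - g k)"

text \<open>Cones let one extension theorem serve both rays, where \<open>g\<close> may be
  \<open>p\<close> itself, and subspaces, where the lower bound turns into an equality.\<close>

definition subcone :: "'a::real_vector set \<Rightarrow> ('a \<Rightarrow> real) \<Rightarrow> ('a \<Rightarrow> real) \<Rightarrow> bool" where
  "subcone K g p \<longleftrightarrow> 0 \<in> K \<and> (\<forall>k\<in>K. \<forall>l\<in>K. k + l \<in> K \<and> g (k + l) = g k + g l) \<and>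
     (\<forall>c>0. \<forall>k\<in>K. c *\<^sub>R k \<in> K \<and> g (c *\<^sub>R k) = c * g k) \<and> (\<forall>k\<in>K. g k \<le> p k)"

lemma cone_inf_lower:
  assumes "sublinear p" "subcone K g p" "k \<in> K"
  shows "- p (- x) \<le> p (x + k) - g k"
proof -
  have "g k \<le> p k" using assms by (simp add: subcone_def)
  moreover have "p k \<le> p (x + k) + p (- x)" using sublinear_add[OF assms(1), of "x + k" "- x"] by simp
  ultimately show ?thesis by simp
qed

lemma cone_inf_le:
  assumes "sublinear p" "subcone K g p" "k \<in> K"
  shows "cone_inf p K g x \<le> p (x + k) - g k"
  unfolding cone_inf_def
  by (rule cINF_lower[OF _ assms(3)]) (auto intro!: bdd_belowI[where m = "- p (- x)"] cone_inf_lower assms)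

lemma cone_inf_ge:
  assumes "subcone K g p" "\<And>k. k \<in> K \<Longrightarrow> a \<le> p (x + k) - g k"
  shows "a \<le> cone_inf p K g x"
  unfolding cone_inf_def
  by (rule cINF_greatest) (use assms in \<open>auto simp: subcone_def\<close>)

lemma subcone_zero: "subcone K g p \<Longrightarrow> g 0 = 0"
  unfolding subcone_def by (metis add_cancel_left_left add.right_neutral)

lemma sublinear_cone_inf:
  assumes p: "sublinear p" and K: "subcone K g p"
  shows "sublinear (cone_inf p K g)"
  unfolding sublinear_def
proof (intro conjI allI impI)
  have "cone_inf p K g 0 \<le> p (0 + 0) - g 0" using K by (intro cone_inf_le[OF p K]) (simp add: subcone_def)
  moreover have "0 \<le> cone_inf p K g 0" by (rule cone_inf_ge[OF K]) (use K in \<open>simp add: subcone_def\<close>)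
  ultimately show "cone_inf p K g 0 = 0" by (simp add: sublinear_zero[OF p] subcone_zero[OF K])
next
  fix x y
  have *: "cone_inf p K g (x + y) \<le> (p (x + k) - g k) + (p (y + l) - g l)" if "k \<in> K" "l \<in> K" for k l
  proof -
    have "cone_inf p K g (x + y) \<le> p (x + y + (k + l)) - g (k + l)"
      using that K by (intro cone_inf_le[OF p K]) (simp add: subcone_def)
    moreover have "p (x + y + (k + l)) \<le> p (x + k) + p (y + l)"
      using sublinear_add[OF p, of "x + k" "y + l"] by (simp add: algebra_simps)
    moreover have "g (k + l) = g k + g l" using that K by (simp add: subcone_def)
    ultimately show ?thesis by simp
  qed
  have "cone_inf p K g (x + y) - (p (x + k) - g k) \<le> cone_inf p K g y" if "k \<in> K" for k
    by (rule cone_inf_ge[OF K]) (use *[OF that] in force)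
  then have "cone_inf p K g (x + y) - cone_inf p K g y \<le> cone_inf p K g x"
    by (intro cone_inf_ge[OF K]) force
  then show "cone_inf p K g (x + y) \<le> cone_inf p K g x + cone_inf p K g y" by simp
next
  fix c :: real and x assume c: "c > 0"
  have "cone_inf p K g (c *\<^sub>R x) / c \<le> p (x + k) - g k" if "k \<in> K" for k
  proof -
    have "cone_inf p K g (c *\<^sub>R x) \<le> p (c *\<^sub>R x + c *\<^sub>R k) - g (c *\<^sub>R k)"
      using that K c by (intro cone_inf_le[OF p K]) (simp add: subcone_def)
    also have "\<dots> = c * (p (x + k) - g k)"
      using that K c sublinear_scaleR[OF p, of c "x + k"]
      by (simp add: subcone_def scaleR_add_right right_diff_distrib)
    finally show ?thesis using c by (simp add: field_simps)
  qed
  then have "cone_inf p K g (c *\<^sub>R x) / c \<le> cone_inf p K g x" by (intro cone_inf_ge[OF K])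
  then show "cone_inf p K g (c *\<^sub>R x) \<le> c * cone_inf p K g x" using c by (simp add: field_simps)
qed

lemma cone_inf_le_self:
  assumes "sublinear p" "subcone K g p"
  shows "cone_inf p K g x \<le> p x"
  using cone_inf_le[OF assms, of 0 x] subcone_zero[OF assms(2)] assms(2) by (simp add: subcone_def)

lemma cone_inf_uminus:
  assumes "sublinear p" "subcone K g p" "k \<in> K"
  shows "cone_inf p K g (- k) \<le> - g k"
  using cone_inf_le[OF assms, of "- k"] sublinear_zero[OF assms(1)] by simp

lemma subcone_ray:
  assumes p: "sublinear p"
  shows "subcone {t *\<^sub>R a |t. t \<ge> 0} p p"
  unfolding subcone_def
proof (intro conjI ballI allI impI)
  show "0 \<in> {t *\<^sub>R a |t. t \<ge> 0}" by (auto intro!: exI[of _ 0])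
next
  fix k l assume "k \<in> {t *\<^sub>R a |t. t \<ge> 0}" "l \<in> {t *\<^sub>R a |t. t \<ge> 0}"
  then obtain s t where st: "k = s *\<^sub>R a" "l = t *\<^sub>R a" "s \<ge> 0" "t \<ge> 0" by auto
  then show "k + l \<in> {t *\<^sub>R a |t. t \<ge> 0}" by (auto intro!: exI[of _ "s + t"] simp: scaleR_add_left)
  have "k + l = (s + t) *\<^sub>R a" using st by (simp add: scaleR_add_left)
  then show "p (k + l) = p k + p l" using st by (simp only:) (simp add: sublinear_scaleR[OF p] distrib_right)
next
  fix c :: real and k assume c: "c > 0" and "k \<in> {t *\<^sub>R a |t. t \<ge> 0}"
  then obtain s where "k = s *\<^sub>R a" "s \<ge> 0" by auto
  then show "c *\<^sub>R k \<in> {t *\<^sub>R a |t. t \<ge> 0}" using c by (auto intro!: exI[of _ "c * s"])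
  show "p (c *\<^sub>R k) = c * p k" using c by (simp add: sublinear_scaleR[OF p])
qed simp

text \<open>A minimal sublinear functional \<open>q\<close> is linear: it cannot lie strictly above its infimum
  \<open>cone_inf q K q\<close> along any ray \<open>K\<close>.\<close>

lemma sublinear_dominates_linear:
  fixes p :: "'a::real_vector \<Rightarrow> real"
  assumes p: "sublinear p"
  obtains f where "linear f" "\<And>x. f x \<le> p x"
proof -
  define A where "A = {q. sublinear q \<and> q \<le> p}"
  \<comment> \<open>The order is reversed, so that the maximal element given by Zorn's lemma is a
    minimal sublinear functional.\<close>
  define P where "P = (\<lambda>q r :: 'a \<Rightarrow> real. r \<le> q)"
  have "\<exists>m\<in>A. \<forall>a\<in>A. P m a \<longrightarrow> a = m"
  proof (rule predicate_Zorn)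
    show "partial_order_on A (relation_of P A)"
      by (rule partial_order_on_relation_ofI) (auto simp: P_def)
    fix C assume "C \<in> Chains (relation_of P A)"
    then have CA: "C \<subseteq> A" and chain: "\<And>q r. q \<in> C \<Longrightarrow> r \<in> C \<Longrightarrow> q \<le> r \<or> r \<le> q"
      by (auto simp: Chains_def relation_of_def P_def)
    show "\<exists>u\<in>A. \<forall>a\<in>C. P a u"
    proof (cases "C = {}")
      case True then show ?thesis using p by (auto simp: A_def)
    next
      case False
      define u where "u x = (INF q\<in>C. q x)" for x
      \<comment> \<open>This bound does not depend on \<open>q\<close>, so the pointwise infimum
        over the chain is finite.\<close>
      have lower: "- p (- x) \<le> q x" if "q \<in> C" for q x
      proof -
        have q: "sublinear q" "q \<le> p" using that CA by (auto simp: A_def)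
        have "- p (- x) \<le> - q (- x)" using q(2) by (simp add: le_fun_def)
        also have "\<dots> \<le> q x" by (rule sublinear_minus[OF q(1)])
        finally show ?thesis .
      qed
      have u_le: "u x \<le> q x" if "q \<in> C" for q x
        unfolding u_def by (rule cINF_lower[OF _ that]) (rule bdd_belowI2[where m = "- p (- x)"], rule lower)
      have u_ge: "a \<le> u x" if "\<And>q. q \<in> C \<Longrightarrow> a \<le> q x" for a x
        unfolding u_def by (rule cINF_greatest[OF False]) (use that in auto)
      have sub: "sublinear q" if "q \<in> C" for q using that CA by (auto simp: A_def)
      have "sublinear u" unfolding sublinear_def
      proof (intro conjI allI impI)
        obtain q where q: "q \<in> C" using False by auto
        have "u 0 \<le> 0" using u_le[OF q, of 0] sublinear_zero[OF sub[OF q]] by simp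
        moreover have "0 \<le> u 0" by (rule u_ge) (simp add: sublinear_zero sub)
        ultimately show "u 0 = 0" by simp
      next
        fix x y
        have *: "u (x + y) \<le> q x + r y" if qr: "q \<in> C" "r \<in> C" for q r
        proof -
          \<comment> \<open>The infima at \<open>x\<close> and \<open>y\<close> may be approached by
            different members of the chain; the smaller of the two members serves for both.\<close>
          obtain s where s: "s \<in> C" "s \<le> q" "s \<le> r" using chain[OF qr] qr by auto
          have "u (x + y) \<le> s x + s y"
            using u_le[OF s(1), of "x + y"] sublinear_add[OF sub[OF s(1)], of x y] by simp
          also have "\<dots> \<le> q x + r y" using s by (intro add_mono) (auto simp: le_fun_def)
          finally show ?thesis .
        qed
        have "u (x + y) - q x \<le> u y" if "q \<in> C" for q
          by (rule u_ge) (use *[OF that] in force)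
        then have "u (x + y) - u y \<le> u x" by (intro u_ge) force
        then show "u (x + y) \<le> u x + u y" by simp
      next
        fix c :: real and x assume c: "c > 0"
        have "u (c *\<^sub>R x) / c \<le> u x"
        proof (rule u_ge)
          fix q assume q: "q \<in> C"
          show "u (c *\<^sub>R x) / c \<le> q x"
            using u_le[OF q, of "c *\<^sub>R x"] sublinear_scaleR[OF sub[OF q], of c x] c by (simp add: field_simps)
        qed
        then show "u (c *\<^sub>R x) \<le> c * u x" using c by (simp add: field_simps)
      qed
      moreover have "u \<le> p"
      proof -
        obtain q where q: "q \<in> C" using False by auto
        then have "u \<le> q" using u_le by (auto simp: le_fun_def)
        also have "q \<le> p" using q CA by (auto simp: A_def)
        finally show ?thesis .
      qed
      ultimately show ?thesis using u_le by (intro bexI[of _ u]) (auto simp: A_def P_def le_fun_def)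
    qed
  qed
  then obtain q where q: "sublinear q" "q \<le> p" and minq: "\<And>r. sublinear r \<Longrightarrow> r \<le> q \<Longrightarrow> r = q"
    unfolding A_def P_def by (smt (verit) mem_Collect_eq order_trans)
  have add: "q (x + a) = q x + q a" for x a
  proof -
    let ?K = "{t *\<^sub>R a |t. t \<ge> 0}"
    have K: "subcone ?K q q" by (rule subcone_ray[OF q(1)])
    have a: "a \<in> ?K" by (auto intro!: exI[of _ 1])
    have "cone_inf q ?K q = q"
      by (rule minq) (auto simp: sublinear_cone_inf[OF q(1) K] le_fun_def cone_inf_le_self[OF q(1) K])
    then have "q x \<le> q (x + a) - q a" using cone_inf_le[OF q(1) K a, of x] by simp
    then show ?thesis using sublinear_add[OF q(1), of x a] by simp
  qed
  have minus: "q (- x) = - q x" for x using add[of x "- x"] sublinear_zero[OF q(1)] by simp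
  have "linear q"
  proof (rule linearI)
    fix c x
    show "q (c *\<^sub>R x) = c *\<^sub>R q x"
    proof (cases "c \<ge> 0")
      case True then show ?thesis by (simp add: sublinear_scaleR[OF q(1)])
    next
      case False
      then have "q (- (c *\<^sub>R x)) = - c * q x" using sublinear_scaleR[OF q(1), of "- c" x] by simp
      then show ?thesis by (simp add: minus)
    qed
  qed (rule add)
  then show ?thesis using that q(2) by (auto simp: le_fun_def)
qed

text \<open>Any linear functional below \<open>cone_inf p K g\<close> works: \<open>k = 0\<close> in
  the infimum gives the bound by \<open>p\<close>, and evaluation at \<open>- k\<close> turns the
  upper bound \<open>- g k\<close> into the lower bound on \<open>K\<close>.\<close>

theorem hahn_banach_cone:
  assumes p: "sublinear p" and K: "subcone K g p"
  obtains f where "linear f" "\<And>x. f x \<le> p x" "\<And>k. k \<in> K \<Longrightarrow> g k \<le> f k"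
proof -
  obtain f where f: "linear f" "\<And>x. f x \<le> cone_inf p K g x"
    using sublinear_dominates_linear[OF sublinear_cone_inf[OF p K]] by blast
  show ?thesis
  proof
    show "f x \<le> p x" for x using f(2)[of x] cone_inf_le_self[OF p K, of x] by simp
    show "g k \<le> f k" if "k \<in> K" for k
      using f(2)[of "- k"] cone_inf_uminus[OF p K that] linear_neg[OF f(1), of k] by simp
  qed (rule f)
qed

text \<open>Prescribing \<open>p\<close> as lower bound on the ray through \<open>a\<close> forces
  equality there.\<close>

corollary hahn_banach_point:
  assumes p: "sublinear p"
  obtains f where "linear f" "\<And>x. f x \<le> p x" "f a = p a"
proof -
  obtain f where f: "linear f" "\<And>x. f x \<le> p x" "\<And>k. k \<in> {t *\<^sub>R a |t. t \<ge> 0} \<Longrightarrow> p k \<le> f k"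
    using hahn_banach_cone[OF p subcone_ray[OF p]] by blast
  have "p a \<le> f a" by (rule f(3)) (auto intro!: exI[of _ 1])
  then show ?thesis using that f(1,2) by (simp add: order_antisym)
qed

section \<open>Bounded functionals: extension from a subspace and separation from it\<close>

lemma linear_le_norm_blinfun:
  fixes f :: "'a::real_normed_vector \<Rightarrow> real"
  assumes f: "linear f" "\<And>x. f x \<le> c * norm x" and c: "c \<ge> 0"
  obtains \<phi> :: "'a \<Rightarrow>\<^sub>L real" where "blinfun_apply \<phi> = f" "norm \<phi> \<le> c"
proof -
  have abs: "\<bar>f x\<bar> \<le> c * norm x" for x
    using f(2)[of x] f(2)[of "- x"] linear_neg[OF f(1), of x] by simp
  have "bounded_linear f"
    by (rule bounded_linear_intro[where K = c])
       (use abs f(1) in \<open>auto simp: linear_add linear_scale mult.commute\<close>)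
  then have ap: "blinfun_apply (Blinfun f) = f" by (rule bounded_linear_Blinfun_apply)
  moreover have "norm (Blinfun f) \<le> c" by (rule norm_blinfun_bound[OF c]) (simp add: ap abs)
  ultimately show ?thesis using that by blast
qed

lemma sublinear_norm: "c \<ge> 0 \<Longrightarrow> sublinear (\<lambda>x. c * norm x)"
  unfolding sublinear_def by (auto simp: distrib_left[symmetric] intro!: mult_left_mono norm_triangle_ineq)

text \<open>Here \<open>\<phi>\<close> is its own lower bound on the cone \<open>Y\<close>; since
  \<open>Y\<close> contains \<open>- y\<close> with \<open>y\<close>, the inequality becomes
  agreement on \<open>Y\<close>. The point is to cut the norm down to that of the restriction to
  \<open>Y\<close>.\<close>

lemma hahn_banach_restriction:
  fixes \<phi> :: "'a::real_normed_vector \<Rightarrow>\<^sub>L real"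
  assumes Y: "subspace Y" and c: "c \<ge> 0" and le: "\<And>y. y \<in> Y \<Longrightarrow> blinfun_apply \<phi> y \<le> c * norm y"
  obtains \<psi> where "norm \<psi> \<le> c" "\<And>y. y \<in> Y \<Longrightarrow> blinfun_apply \<psi> y = blinfun_apply \<phi> y"
proof -
  have "subcone Y \<phi> (\<lambda>x. c * norm x)"
    unfolding subcone_def using Y le
    by (auto simp: subspace_0 subspace_add subspace_scale blinfun.add_right blinfun.scaleR_right)
  then obtain f where f: "linear f" "\<And>x. f x \<le> c * norm x" "\<And>k. k \<in> Y \<Longrightarrow> \<phi> k \<le> f k"
    using hahn_banach_cone[OF sublinear_norm[OF c]] by blast
  have "f y = \<phi> y" if "y \<in> Y" for y
    using f(3)[OF that] f(3)[OF subspace_neg[OF Y that]] linear_neg[OF f(1), of y]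
    by (simp add: blinfun.minus_right)
  then show ?thesis using linear_le_norm_blinfun[OF f(1,2) c] that by metis
qed

lemma subcone_subspace_zero:
  assumes "subspace Y" "\<And>x. p x \<ge> 0"
  shows "subcone Y (\<lambda>_. 0) p"
  unfolding subcone_def using assms by (auto simp: subspace_0 subspace_add subspace_scale)

text \<open>The sublinear functional is the distance to \<open>Y\<close>, positive at
  \<open>b\<close> because \<open>Y\<close> is closed. A functional dominated by it and equal to it
  at \<open>b\<close> vanishes on \<open>Y\<close>; rescaling makes its value at \<open>b\<close>
  equal to 1.\<close>

lemma hahn_banach_annihilator:
  fixes Y :: "'a::real_normed_vector set"
  assumes Y: "subspace Y" "closed Y" and b: "b \<notin> Y"
  obtains \<phi> :: "'a \<Rightarrow>\<^sub>L real" where "\<And>y. y \<in> Y \<Longrightarrow> blinfun_apply \<phi> y = 0" "blinfun_apply \<phi> b = 1"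
proof -
  define p where "p = cone_inf norm Y (\<lambda>_. 0)"
  have n: "sublinear norm" using sublinear_norm[of 1] by simp
  have K: "subcone Y (\<lambda>_. 0) norm" by (rule subcone_subspace_zero[OF Y(1)]) simp
  have p: "sublinear p" unfolding p_def by (rule sublinear_cone_inf[OF n K])
  obtain f where f: "linear f" "\<And>x. f x \<le> p x" "f b = p b" using hahn_banach_point[OF p] by blast
  obtain e where e: "e > 0" "\<And>y. dist y b < e \<Longrightarrow> y \<notin> Y"
    using Y(2) b by (metis ComplD ComplI open_Compl open_dist)
  have "e \<le> p b" unfolding p_def
  proof (rule cone_inf_ge[OF K])
    fix k assume "k \<in> Y"
    then have "- k \<in> Y" by (rule subspace_neg[OF Y(1)])
    then have "\<not> dist (- k) b < e" using e(2) by blast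
    then show "e \<le> norm (b + k) - 0" by (simp add: dist_norm norm_minus_commute)
  qed
  then have pb: "p b > 0" using e by simp
  have fle: "f x \<le> 1 * norm x" for x using f(2)[of x] cone_inf_le_self[OF n K, of x] by (simp add: p_def)
  then obtain \<phi> :: "'a \<Rightarrow>\<^sub>L real" where \<phi>: "blinfun_apply \<phi> = f"
    using linear_le_norm_blinfun[OF f(1) fle zero_le_one] by blast
  have le0: "f (- y) \<le> 0" if "y \<in> Y" for y
    using f(2)[of "- y"] cone_inf_uminus[OF n K that] by (simp add: p_def)
  have z: "f y = 0" if "y \<in> Y" for y
    using le0[OF that] le0[OF subspace_neg[OF Y(1) that]] linear_neg[OF f(1), of y] by simp
  show ?thesis
    by (rule that[of "(1 / p b) *\<^sub>R \<phi>"]) (use z f(3) pb in \<open>auto simp: \<phi> scaleR_blinfun.rep_eq\<close>)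
qed

subsection \<open>Annihilators and subspaces of finite codimension\<close>

definition pre_annihilator :: "('a::real_normed_vector \<Rightarrow>\<^sub>L real) set \<Rightarrow> 'a set" where
  "pre_annihilator E = {x. \<forall>\<phi>\<in>E. blinfun_apply \<phi> x = 0}"

definition annihilator :: "'a::real_normed_vector set \<Rightarrow> ('a \<Rightarrow>\<^sub>L real) set" where
  "annihilator Y = {\<phi>. \<forall>y\<in>Y. blinfun_apply \<phi> y = 0}"

lemma closed_subspace_pre_annihilator: "closed_subspace (pre_annihilator E)"
proof -
  have "closed {x. blinfun_apply \<phi> x = 0}" for \<phi> :: "'a \<Rightarrow>\<^sub>L real"
    by (intro closed_Collect_eq continuous_intros)
  moreover have "pre_annihilator E = (\<Inter>\<phi>\<in>E. {x. blinfun_apply \<phi> x = 0})"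
    by (auto simp: pre_annihilator_def)
  ultimately have "closed (pre_annihilator E)" by auto
  moreover have "subspace (pre_annihilator E)"
    by (auto simp: subspace_def pre_annihilator_def blinfun.add_right blinfun.scaleR_right)
  ultimately show ?thesis by (simp add: closed_subspace_def)
qed

text \<open>Induction on \<open>E\<close>. If the new functional \<open>e\<close> does not vanish on
  the old kernel, pick \<open>b\<close> there with \<open>e b = 1\<close>. The map
  \<open>x \<mapsto> x - e x *\<^sub>R b\<close> sends the old kernel into the new one, so
  subtracting a multiple of \<open>e\<close> from \<open>\<phi>\<close> reduces to the smaller
  set.\<close>

lemma annihilator_pre_annihilator_subset_span:
  assumes "finite E"
  shows "annihilator (pre_annihilator E) \<subseteq> span E"
proof
  fix \<phi> assume "\<phi> \<in> annihilator (pre_annihilator E)"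
  with assms show "\<phi> \<in> span E"
  proof (induction E arbitrary: \<phi>)
    case empty
    then have "\<phi> = 0" by (intro blinfun_eqI) (auto simp: annihilator_def pre_annihilator_def)
    then show ?case by simp
  next
    case (insert e E)
    show ?case
    proof (cases "\<forall>x\<in>pre_annihilator E. blinfun_apply e x = 0")
      case True
      then have "pre_annihilator (insert e E) = pre_annihilator E" by (auto simp: pre_annihilator_def)
      with insert have "\<phi> \<in> span E" by simp
      then show ?thesis using span_mono[of E "insert e E"] by auto
    next
      case False
      then obtain b' where b': "b' \<in> pre_annihilator E" "blinfun_apply e b' \<noteq> 0" by auto
      define b where "b = (1 / blinfun_apply e b') *\<^sub>R b'"
      have b: "b \<in> pre_annihilator E" "blinfun_apply e b = 1"
        using b' by (auto simp: b_def pre_annihilator_def blinfun.scaleR_right)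
      have "\<phi> - \<phi> b *\<^sub>R e \<in> annihilator (pre_annihilator E)"
        unfolding annihilator_def
      proof safe
        fix x assume x: "x \<in> pre_annihilator E"
        have "x - e x *\<^sub>R b \<in> pre_annihilator (insert e E)"
          using x b by (auto simp: pre_annihilator_def blinfun.diff_right blinfun.scaleR_right)
        then have "\<phi> (x - e x *\<^sub>R b) = 0" using insert.prems by (simp add: annihilator_def)
        then show "(\<phi> - \<phi> b *\<^sub>R e) x = 0"
          by (simp add: blinfun.diff_right blinfun.scaleR_right blinfun.diff_left blinfun.scaleR_left)
      qed
      then have "\<phi> - \<phi> b *\<^sub>R e \<in> span E" using insert by blast
      then have "\<phi> - \<phi> b *\<^sub>R e \<in> span (insert e E)" using span_mono[of E "insert e E"] by auto
      moreover have "\<phi> b *\<^sub>R e \<in> span (insert e E)" by (intro span_scale span_base) simp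
      ultimately have "(\<phi> - \<phi> b *\<^sub>R e) + \<phi> b *\<^sub>R e \<in> span (insert e E)" by (rule span_add)
      then show ?thesis by simp
    qed
  qed
qed

lemma finite_codim_pre_annihilator:
  assumes "closed_subspace Y" "finite_codim Y"
  obtains F where "finite F" "Y = pre_annihilator F"
proof -
  have "\<exists>F. finite F \<and> Y = pre_annihilator F"
    if "finite B" "span (Y \<union> B) = UNIV" "subspace Y" "closed Y" for Y B :: "'a set"
    using that
  proof (induction B arbitrary: Y)
    case empty
    then have "Y = UNIV" by (simp add: span_eq_iff[THEN iffD2])
    then show ?case by (intro exI[of _ "{}"]) (auto simp: pre_annihilator_def)
  next
    case (insert b B)
    show ?case
    proof (cases "b \<in> Y")
      case True
      then have "Y \<union> insert b B = Y \<union> B" by auto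
      then show ?thesis using insert by simp
    next
      case False
      obtain f :: "'a \<Rightarrow>\<^sub>L real" where f: "\<And>y. y \<in> Y \<Longrightarrow> f y = 0" "f b = 1"
        using hahn_banach_annihilator[OF insert.prems(2,3) False] by blast
      \<comment> \<open>This is the sum of \<open>Y\<close> and the line through \<open>b\<close>;
        writing it by means of \<open>f\<close> exhibits it as a preimage of \<open>Y\<close> under
        a continuous map, hence closed. \<open>Y\<close> is recovered from it as the kernel of
        \<open>f\<close>.\<close>
      define Y' where "Y' = {x. x - f x *\<^sub>R b \<in> Y}"
      have "closed ((\<lambda>x. x - f x *\<^sub>R b) -` Y)"
        by (intro closed_vimage continuous_intros insert.prems)
      then have cl: "closed Y'" by (simp add: Y'_def vimage_def)
      have sub: "subspace Y'"
        unfolding subspace_def Y'_def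
      proof safe
        show "0 - f 0 *\<^sub>R b \<in> Y" using subspace_0[OF insert.prems(2)] by (simp add: blinfun.zero_right)
      next
        fix x y assume "x - f x *\<^sub>R b \<in> Y" "y - f y *\<^sub>R b \<in> Y"
        from subspace_add[OF insert.prems(2) this] show "x + y - f (x + y) *\<^sub>R b \<in> Y"
          by (simp add: blinfun.add_right algebra_simps)
      next
        fix c x assume "x - f x *\<^sub>R b \<in> Y"
        from subspace_scale[OF insert.prems(2) this, of c] show "c *\<^sub>R x - f (c *\<^sub>R x) *\<^sub>R b \<in> Y"
          by (simp add: blinfun.scaleR_right algebra_simps)
      qed
      have "Y \<union> insert b B \<subseteq> Y' \<union> B"
        using f subspace_0[OF insert.prems(2)] by (auto simp: Y'_def)
      then have "span (Y' \<union> B) = UNIV" using insert.prems(1) span_mono by blast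
      then obtain F where F: "finite F" "Y' = pre_annihilator F" using insert.IH sub cl by blast
      have "Y = {x \<in> Y'. f x = 0}" using f(1) by (auto simp: Y'_def)
      also have "\<dots> = pre_annihilator (insert f F)" using F by (auto simp: pre_annihilator_def)
      finally show ?thesis using F(1) by blast
    qed
  qed
  then show ?thesis using assms that unfolding finite_codim_def closed_subspace_def by metis
qed

text \<open>Compactness in the finite dimensional quotient by the common kernel, expressed through
  representatives. Each functional of \<open>E\<close> costs one application of
  Bolzano--Weierstrass.\<close>

lemma bounded_subseq_convergent_mod_pre_annihilator:
  fixes x :: "nat \<Rightarrow> 'a::real_normed_vector"
  assumes "finite E" "bounded (range x)"
  obtains r v z where "strict_mono (r :: nat \<Rightarrow> nat)" "range z \<subseteq> pre_annihilator E"
    "(\<lambda>n. x (r n) - z n) \<longlonglongrightarrow> v"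
proof -
  have "\<exists>r v z. strict_mono (r :: nat \<Rightarrow> nat) \<and> range z \<subseteq> pre_annihilator E \<and>
    (\<lambda>n. x (r n) - z n) \<longlonglongrightarrow> v"
    using assms(1)
  proof (induction E)
    case empty
    show ?case
      by (rule exI[of _ id], rule exI[of _ 0], rule exI[of _ x])
         (auto simp: pre_annihilator_def strict_mono_def)
  next
    case (insert e E)
    then obtain r v z where r: "strict_mono (r :: nat \<Rightarrow> nat)" and "range z \<subseteq> pre_annihilator E"
      and v: "(\<lambda>n. x (r n) - z n) \<longlonglongrightarrow> v" by blast
    then have z: "z n \<in> pre_annihilator E" for n by auto
    show ?case
    proof (cases "\<forall>x\<in>pre_annihilator E. blinfun_apply e x = 0")
      case True
      then have "pre_annihilator (insert e E) = pre_annihilator E" by (auto simp: pre_annihilator_def)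
      with r z v show ?thesis by auto
    next
      case False
      then obtain b' where b': "b' \<in> pre_annihilator E" "blinfun_apply e b' \<noteq> 0" by auto
      define b where "b = (1 / blinfun_apply e b') *\<^sub>R b'"
      have b: "b \<in> pre_annihilator E" "blinfun_apply e b = 1"
        using b' by (auto simp: b_def pre_annihilator_def blinfun.scaleR_right)
      have "bounded (range (\<lambda>n. x (r n) - z n))" using v convergent_imp_bounded by blast
      moreover have "bounded (range (\<lambda>n. x (r n)))"
        by (rule bounded_subset[OF assms(2)]) auto
      ultimately have "bounded (range (\<lambda>n. x (r n) - (x (r n) - z n)))"
        by (rule bounded_minus_comp[rotated])
      then have "bounded (range z)" by simp
      then have "bounded (range (\<lambda>n. e (z n)))"
        using bounded_linear_image[OF _ blinfun.bounded_linear_right, of "range z" e]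
        by (simp add: image_image)
      then obtain c s where s: "strict_mono (s :: nat \<Rightarrow> nat)" and c: "((\<lambda>n. e (z n)) \<circ> s) \<longlonglongrightarrow> c"
        using bounded_imp_convergent_subsequence by blast
      \<comment> \<open>The correction moves \<open>z (s n)\<close> into the kernel of
        \<open>e\<close>. What is taken away is a multiple of the fixed vector \<open>b\<close>
        whose coefficients converge along \<open>s\<close>.\<close>
      define z' where "z' n = z (s n) - e (z (s n)) *\<^sub>R b" for n
      have "z' n \<in> pre_annihilator (insert e E)" for n
        using z[of "s n"] b by (auto simp: z'_def pre_annihilator_def blinfun.diff_right blinfun.scaleR_right)
      moreover have "(\<lambda>n. x (r (s n)) - z (s n) + e (z (s n)) *\<^sub>R b) \<longlonglongrightarrow> v + c *\<^sub>R b"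
        using LIMSEQ_subseq_LIMSEQ[OF v s] c by (intro tendsto_intros) (simp_all add: o_def)
      then have "(\<lambda>n. x ((r \<circ> s) n) - z' n) \<longlonglongrightarrow> v + c *\<^sub>R b" by (simp add: z'_def algebra_simps)
      ultimately show ?thesis using strict_mono_o[OF r s] by blast
    qed
  qed
  then show ?thesis using that by blast
qed

lemma bounded_range_if_norm_tendsto:
  assumes "(\<lambda>n. norm (x - y n)) \<longlonglongrightarrow> d"
  shows "bounded (range (y :: nat \<Rightarrow> 'a::real_normed_vector))"
proof -
  have "bounded (range (\<lambda>n. norm (x - y n)))" using assms convergent_imp_bounded by blast
  then have "bounded (range (\<lambda>n. x - y n))" by (auto simp: bounded_iff)
  then have "bounded (range (\<lambda>n. x - (x - y n)))" by (rule bounded_minus_comp[rotated]) simp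
  then show ?thesis by simp
qed

section \<open>Strong proximinality and almost maximal points of a functional\<close>

text \<open>The property that makes \<open>\<phi>\<close> a strong subdifferentiability point of the dual norm:
  almost maximal points of the unit ball lie near the face where \<open>\<phi> = 1\<close>.\<close>

lemma strongly_proximinal_near_face:
  fixes Y Z :: "'a::real_normed_vector set" and \<phi> :: "'a \<Rightarrow>\<^sub>L real"
  assumes sp: "strongly_proximinal Z Y" and fc: "finite_codim Z"
    and \<phi>Z: "\<phi> \<in> annihilator Z" and \<phi>Y: "\<And>y. y \<in> Y \<Longrightarrow> \<phi> y \<le> norm y" and \<epsilon>: "\<epsilon> > 0"
  shows "\<exists>\<delta>>0. \<forall>w\<in>Y. norm w \<le> 1 \<and> \<phi> w > 1 - \<delta> \<longrightarrow>
    (\<exists>v\<in>Y. norm v \<le> 1 \<and> \<phi> v = 1 \<and> norm (w - v) < \<epsilon>)"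
proof (rule ccontr)
  assume "\<not> ?thesis"
  then have bad: "\<exists>w\<in>Y. norm w \<le> 1 \<and> \<phi> w > 1 - \<delta> \<and> (\<forall>v\<in>Y. norm v \<le> 1 \<and> \<phi> v = 1 \<longrightarrow> norm (w - v) \<ge> \<epsilon>)"
    if "\<delta> > 0" for \<delta>
    using that by (meson not_le)
  have "\<exists>w. w \<in> Y \<and> norm w \<le> 1 \<and> \<phi> w > 1 - 1 / real (Suc n) \<and>
      (\<forall>v\<in>Y. norm v \<le> 1 \<and> \<phi> v = 1 \<longrightarrow> norm (w - v) \<ge> \<epsilon>)" for n
    using bad[of "1 / real (Suc n)"] by auto
  then obtain w where wY: "\<And>n. w n \<in> Y" and w1: "\<And>n. norm (w n) \<le> 1"
    and \<phi>w: "\<And>n. \<phi> (w n) > 1 - 1 / real (Suc n)"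
    and far: "\<And>n v. v \<in> Y \<Longrightarrow> norm v \<le> 1 \<Longrightarrow> \<phi> v = 1 \<Longrightarrow> norm (w n - v) \<ge> \<epsilon>"
    by metis
  have Z: "closed_subspace Z" and Y: "subspace Y" "closed Y" and ZY: "Z \<subseteq> Y"
    using sp by (auto simp: strongly_proximinal_def proximinal_def closed_subspace_def)
  obtain F where F: "finite F" "Z = pre_annihilator F" using finite_codim_pre_annihilator[OF Z fc] .
  \<comment> \<open>The almost maximal points \<open>w n\<close>, all far from the face, need not
    converge, but a subsequence converges modulo \<open>Z\<close> to some \<open>v\<close>. Strong
    proximinality is then applied to \<open>v\<close>.\<close>
  have "bounded (range w)" using w1 by (auto simp: bounded_iff)
  then obtain r v z where r: "strict_mono (r :: nat \<Rightarrow> nat)" and "range z \<subseteq> Z"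
    and lim: "(\<lambda>n. w (r n) - z n) \<longlonglongrightarrow> v"
    using bounded_subseq_convergent_mod_pre_annihilator[OF F(1)] F(2) by metis
  then have z: "z n \<in> Z" for n by auto
  have vY: "v \<in> Y"
    by (rule closed_sequentially[OF Y(2) _ lim]) (use wY z ZY Y(1) in \<open>auto intro: subspace_diff\<close>)
  have \<phi>lim: "(\<lambda>n. \<phi> (w n)) \<longlonglongrightarrow> 1"
  proof (rule tendsto_sandwich)
    show "(\<lambda>n. 1 - 1 / real (Suc n)) \<longlonglongrightarrow> 1"
      using tendsto_diff[OF tendsto_const LIMSEQ_Suc[OF lim_1_over_n], of 1] by simp
    show "\<forall>\<^sub>F n in sequentially. 1 - 1 / real (Suc n) \<le> \<phi> (w n)"
      using \<phi>w by (intro always_eventually) (auto intro: less_imp_le)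
    show "\<forall>\<^sub>F n in sequentially. \<phi> (w n) \<le> 1"
      using \<phi>Y[OF wY] w1 by (intro always_eventually) (auto intro: order_trans)
  qed simp
  \<comment> \<open>The corrections \<open>z n\<close> are invisible to \<open>\<phi>\<close>, so
    \<open>v\<close> lies on the hyperplane \<open>\<phi> = 1\<close>. Its norm may exceed 1; only
    its distance to \<open>Z\<close> turns out to be 1.\<close>
  have "(\<lambda>n. \<phi> (w (r n) - z n)) \<longlonglongrightarrow> \<phi> v" by (intro tendsto_intros lim)
  moreover have "\<phi> (w (r n) - z n) = \<phi> (w (r n))" for n
    using z \<phi>Z by (simp add: blinfun.diff_right annihilator_def)
  moreover have "(\<lambda>n. \<phi> (w (r n))) \<longlonglongrightarrow> 1" using LIMSEQ_subseq_LIMSEQ[OF \<phi>lim r] by (simp add: o_def)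
  ultimately have \<phi>v: "\<phi> v = 1" using LIMSEQ_unique by auto
  then have vZ: "v \<notin> Z" using \<phi>Z by (auto simp: annihilator_def)
  have ge1: "1 \<le> norm (v - y)" if "y \<in> Z" for y
    using \<phi>Y[of "v - y"] that ZY vY Y(1) \<phi>Z \<phi>v by (auto simp: blinfun.diff_right annihilator_def subspace_diff)
  \<comment> \<open>With this sign \<open>v - y n\<close> is asymptotically \<open>w (r n)\<close>,
    of norm at most 1, so \<open>y\<close> is a minimizing sequence for \<open>v\<close>.\<close>
  define y where "y n = - z n" for n
  have y: "y n \<in> Z" for n using z Z by (simp add: y_def closed_subspace_def subspace_neg)
  have err: "(\<lambda>n. norm (w (r n) - z n - v)) \<longlonglongrightarrow> 0" using lim tendsto_norm_zero LIM_zero by blast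
  have ny: "(\<lambda>n. norm (v - y n)) \<longlonglongrightarrow> 1"
  proof (rule tendsto_sandwich)
    show "\<forall>\<^sub>F n in sequentially. 1 \<le> norm (v - y n)" using ge1 y by simp
    have "norm (v - y n) \<le> 1 + norm (w (r n) - z n - v)" for n
    proof -
      have "norm (v - y n) = norm (w (r n) - (w (r n) - z n - v))" by (simp add: y_def)
      also have "\<dots> \<le> norm (w (r n)) + norm (w (r n) - z n - v)" by (rule norm_triangle_ineq4)
      finally show ?thesis using w1[of "r n"] by simp
    qed
    then show "\<forall>\<^sub>F n in sequentially. norm (v - y n) \<le> 1 + norm (w (r n) - z n - v)" by simp
    show "(\<lambda>n. 1 + norm (w (r n) - z n - v)) \<longlonglongrightarrow> 1" using tendsto_add[OF tendsto_const err, of 1] by simp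
  qed simp
  have ne: "Z \<noteq> {}" using y by auto
  have inf1: "infdist v Z = 1"
  proof (rule antisym)
    show "infdist v Z \<le> 1"
      by (rule LIMSEQ_le_const[OF ny]) (use infdist_le[OF y] in \<open>auto simp: dist_norm\<close>)
    show "1 \<le> infdist v Z"
      unfolding infdist_notempty[OF ne] by (rule cINF_greatest[OF ne]) (use ge1 in \<open>auto simp: dist_norm\<close>)
  qed
  have "\<exists>(s :: nat \<Rightarrow> nat) \<zeta>. strict_mono s \<and> range \<zeta> \<subseteq> best_approx Z v \<and>
      (\<lambda>k. norm (y (s k) - \<zeta> k)) \<longlonglongrightarrow> 0"
    using sp vY vZ y ny inf1 unfolding strongly_proximinal_def by (simp add: image_subset_iff)
  then obtain s \<zeta> where s: "strict_mono (s :: nat \<Rightarrow> nat)" and \<zeta>: "range \<zeta> \<subseteq> best_approx Z v"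
    and lim2: "(\<lambda>k. norm (y (s k) - \<zeta> k)) \<longlonglongrightarrow> 0" by blast
  have \<zeta>': "\<zeta> k \<in> Z" "norm (v - \<zeta> k) = 1" for k
    using \<zeta> inf1 by (auto simp: best_approx_def image_subset_iff)
  \<comment> \<open>Subtracting a best approximation from \<open>v\<close> gives a point of the
    face, and by the choice of \<open>\<zeta>\<close> it approaches \<open>w\<close> along the
    subsequence, against \<open>far\<close>.\<close>
  have "\<epsilon> \<le> norm (w (r (s k)) - z (s k) - v) + norm (y (s k) - \<zeta> k)" for k
  proof -
    have "\<epsilon> \<le> norm (w (r (s k)) - (v - \<zeta> k))"
      using \<zeta>'[of k] vY ZY Y(1) \<phi>v \<phi>Z
      by (intro far) (auto simp: blinfun.diff_right annihilator_def subspace_diff)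
    also have "\<dots> = norm ((w (r (s k)) - z (s k) - v) - (y (s k) - \<zeta> k))"
      by (simp add: y_def algebra_simps)
    also have "\<dots> \<le> norm (w (r (s k)) - z (s k) - v) + norm (y (s k) - \<zeta> k)"
      by (rule norm_triangle_ineq4)
    finally show ?thesis .
  qed
  moreover have "(\<lambda>k. norm (w (r (s k)) - z (s k) - v) + norm (y (s k) - \<zeta> k)) \<longlonglongrightarrow> 0 + 0"
    using LIMSEQ_subseq_LIMSEQ[OF err s] lim2 by (intro tendsto_add) (simp_all add: o_def)
  ultimately have "\<epsilon> \<le> 0 + 0" by (intro LIMSEQ_le_const) auto
  then show False using \<epsilon> by simp
qed

subsection \<open>M-ideals\<close>

text \<open>If the annihilator of \<open>J\<close> is an L-summand of the dual,
  \<open>\<beta>\<close> can be taken in the complementary summand. Additivity is required against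
  every \<open>\<gamma>\<close>, not just \<open>\<alpha>\<close>, since two functionals sharing the
  same \<open>\<beta>\<close> get compared below.\<close>

definition M_ideal :: "'a::real_normed_vector set \<Rightarrow> bool" where
  "M_ideal J \<longleftrightarrow> closed_subspace J \<and>
     (\<forall>\<psi>. \<exists>\<alpha> \<beta>. \<psi> = \<alpha> + \<beta> \<and> \<alpha> \<in> annihilator J \<and>
        (\<forall>\<gamma>\<in>annihilator J. norm (\<gamma> + \<beta>) = norm \<gamma> + norm \<beta>))"

lemma annihilator_le_infdist:
  assumes "\<phi> \<in> annihilator J" "J \<noteq> {}"
  shows "blinfun_apply \<phi> x \<le> norm \<phi> * infdist x J"
proof (cases "norm \<phi> = 0")
  case False
  have "\<phi> x / norm \<phi> \<le> infdist x J"
    unfolding infdist_notempty[OF assms(2)]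
  proof (rule cINF_greatest[OF assms(2)])
    fix j assume "j \<in> J"
    then have "\<phi> x = \<phi> (x - j)" using assms(1) by (simp add: annihilator_def blinfun.diff_right)
    also have "\<dots> \<le> norm \<phi> * norm (x - j)" using norm_blinfun[of \<phi> "x - j"] by simp
    finally show "\<phi> x / norm \<phi> \<le> dist x j" using False by (simp add: field_simps dist_norm)
  qed
  then show ?thesis using False by (simp add: field_simps)
qed simp

lemma norm_blinfun_le_ball:
  fixes \<phi> :: "'a::real_normed_vector \<Rightarrow>\<^sub>L real"
  assumes d: "d > 0" and le: "\<And>x. norm x \<le> d \<Longrightarrow> \<phi> x \<le> k"
  shows "d * norm \<phi> \<le> k"
proof -
  have k: "k \<ge> 0" using le[of 0] d by (simp add: blinfun.zero_right)
  have "norm \<phi> \<le> k / d"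
  proof (rule norm_blinfun_bound)
    fix x
    have *: "\<phi> x \<le> k / d * norm x" for x
    proof (cases "x = 0")
      case False
      have "\<phi> ((d / norm x) *\<^sub>R x) \<le> k" using d False by (intro le) simp
      then show ?thesis using False d by (simp add: blinfun.scaleR_right field_simps)
    qed (simp add: blinfun.zero_right)
    show "norm (\<phi> x) \<le> k / d * norm x" using *[of x] *[of "- x"] by (simp add: blinfun.minus_right abs_le_iff)
  qed (use d k in simp)
  then show ?thesis using d by (simp add: field_simps)
qed

text \<open>A point of the coset \<open>x + J\<close> is sought in two balls, about 0 and about
  \<open>u\<close>. The balls meet each other, and up to \<open>\<eta>\<close> each meets the coset.
  If there were no common point, Hahn--Banach in the product space would give a pair of functionals
  that the decomposition of the dual rules out.\<close>

lemma M_ideal_two_balls: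
  fixes J :: "'a::real_normed_vector set"
  assumes J: "M_ideal J" and d: "0 \<le> d" "infdist x J \<le> d"
    and \<epsilon>: "0 \<le> \<epsilon>" "infdist (x - u) J \<le> \<epsilon>" and u: "norm u \<le> d + \<epsilon>" and \<eta>: "\<eta> > 0"
  obtains w where "x - w \<in> J" "norm w \<le> d + \<eta>" "norm (w - u) \<le> \<epsilon> + \<eta>"
proof -
  define d' where "d' = d + \<eta>"
  define \<epsilon>' where "\<epsilon>' = \<epsilon> + \<eta>"
  have pos: "d' > 0" "\<epsilon>' > 0" using d \<epsilon> \<eta> by (auto simp: d'_def \<epsilon>'_def)
  \<comment> \<open>The closed unit ball of \<open>N\<close> is the product of the balls of radii
    \<open>d'\<close> and \<open>\<epsilon>'\<close>. The element \<open>j\<close> exists precisely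
    when the point \<open>(x, x - u)\<close> can be moved into it along the diagonal copy
    \<open>D\<close> of \<open>J\<close>.\<close>
  define N where "N = (\<lambda>(a, b). max (norm (a :: 'a) / d') (norm (b :: 'a) / \<epsilon>'))"
  define D where "D = {(j, j) |j. j \<in> J}"
  have subJ: "subspace J" using J by (simp add: M_ideal_def closed_subspace_def)
  then have ne: "J \<noteq> {}" using subspace_0 by auto
  have N: "sublinear N"
    unfolding sublinear_def
  proof (intro conjI allI impI)
    fix x y :: "'a \<times> 'a"
    obtain a b a' b' where xy: "x = (a, b)" "y = (a', b')" by (metis surj_pair)
    have "norm (a + a') / d' \<le> norm a / d' + norm a' / d'"
      using pos norm_triangle_ineq[of a a'] by (simp add: divide_right_mono flip: add_divide_distrib)
    moreover have "norm (b + b') / \<epsilon>' \<le> norm b / \<epsilon>' + norm b' / \<epsilon>'"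
      using pos norm_triangle_ineq[of b b'] by (simp add: divide_right_mono flip: add_divide_distrib)
    ultimately show "N (x + y) \<le> N x + N y" by (simp add: N_def xy) linarith
  next
    fix c :: real and x :: "'a \<times> 'a" assume "c > 0"
    then show "N (c *\<^sub>R x) \<le> c * N x"
      by (cases x) (simp add: N_def max_mult_distrib_left)
  qed (simp add: N_def zero_prod_def)
  have "subspace D" unfolding D_def subspace_def
    using subJ by (auto simp: zero_prod_def subspace_0 subspace_add subspace_scale)
  then have K: "subcone D (\<lambda>_. 0) N"
    by (rule subcone_subspace_zero) (use pos in \<open>auto simp: N_def le_max_iff_disj split: prod.split\<close>)
  have "\<exists>j\<in>J. N (x - j, x - u - j) \<le> 1"
  proof (rule ccontr)
    assume "\<not> ?thesis"
    then have gt: "N (x - j, x - u - j) \<ge> 1" if "j \<in> J" for j using that by force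
    define p where "p = cone_inf N D (\<lambda>_. 0)"
    have p: "sublinear p" unfolding p_def by (rule sublinear_cone_inf[OF N K])
    obtain F where F: "linear F" "\<And>y. F y \<le> p y" "F (x, x - u) = p (x, x - u)"
      using hahn_banach_point[OF p] by blast
    have "1 \<le> p (x, x - u)"
      unfolding p_def
    proof (rule cone_inf_ge[OF K])
      fix k assume "k \<in> D"
      then obtain j where j: "k = (j, j)" "j \<in> J" by (auto simp: D_def)
      then show "1 \<le> N ((x, x - u) + k) - 0"
        using gt[of "- j"] subspace_neg[OF subJ j(2)] by simp
    qed
    then have F1: "F (x, x - u) \<ge> 1" using F(3) by simp
    have FN: "F y \<le> N y" for y using F(2)[of y] cone_inf_le_self[OF N K, of y] by (simp add: p_def)
    have lin: "linear (\<lambda>a. F (a, 0))" "linear (\<lambda>b. F (0, b))"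
      using linear_add[OF F(1), of "(_, 0)" "(_, 0)"] linear_add[OF F(1), of "(0, _)" "(0, _)"]
        linear_scale[OF F(1), of _ "(_, 0)"] linear_scale[OF F(1), of _ "(0, _)"]
      by (auto intro!: linearI)
    have "F (a, 0) \<le> (1 / d') * norm a" for a using FN[of "(a, 0)"] pos by (simp add: N_def)
    then obtain \<phi> :: "'a \<Rightarrow>\<^sub>L real" where \<phi>: "blinfun_apply \<phi> = (\<lambda>a. F (a, 0))"
      using linear_le_norm_blinfun[OF lin(1)] pos by (metis divide_nonneg_pos zero_le_one)
    have "F (0, b) \<le> (1 / \<epsilon>') * norm b" for b using FN[of "(0, b)"] pos by (simp add: N_def)
    then obtain \<psi> :: "'a \<Rightarrow>\<^sub>L real" where \<psi>: "blinfun_apply \<psi> = (\<lambda>b. F (0, b))"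
      using linear_le_norm_blinfun[OF lin(2)] pos by (metis divide_nonneg_pos zero_le_one)
    have Fab: "F (a, b) = \<phi> a + \<psi> b" for a b using linear_add[OF F(1), of "(a, 0)" "(0, b)"] by (simp add: \<phi> \<psi>)
    have ball: "\<phi> a + \<psi> b \<le> 1" if "norm a \<le> d'" "norm b \<le> \<epsilon>'" for a b
      using FN[of "(a, b)"] that pos unfolding Fab N_def by (simp add: order_trans)
    \<comment> \<open>The two balls are independent, so the bound can be maximized first over
      \<open>a\<close> and then over \<open>b\<close>.\<close>
    have "d' * norm \<phi> \<le> 1 - \<psi> b" if "norm b \<le> \<epsilon>'" for b
      by (rule norm_blinfun_le_ball[OF pos(1)]) (use ball that in force)
    then have "\<epsilon>' * norm \<psi> \<le> 1 - d' * norm \<phi>"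
      by (intro norm_blinfun_le_ball[OF pos(2)]) force
    then have norms: "d' * norm \<phi> + \<epsilon>' * norm \<psi> \<le> 1" by simp
    have le0: "F (- j, - j) \<le> 0" if "j \<in> J" for j
      using F(2)[of "(- j, - j)"] cone_inf_uminus[OF N K, of "(j, j)"] that by (auto simp: p_def D_def)
    \<comment> \<open>\<open>F\<close> vanishes on the diagonal \<open>D\<close>, which says that
      the sum of its two components annihilates \<open>J\<close>.\<close>
    define \<gamma> where "\<gamma> = \<phi> + \<psi>"
    have \<gamma>: "\<gamma> \<in> annihilator J" unfolding annihilator_def
    proof safe
      fix j assume "j \<in> J"
      then show "\<gamma> j = 0" using le0[of j] le0[of "- j"] subspace_neg[OF subJ, of j]
        by (simp add: Fab \<gamma>_def blinfun.add_left blinfun.minus_right)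
    qed
    \<comment> \<open>Decomposing \<open>- \<psi>\<close> gives
      \<open>\<phi> = (\<gamma> + \<alpha>) + \<beta>\<close> with the same \<open>\<beta>\<close>.
      In \<open>\<phi> x + \<psi> (x - u)\<close> the \<open>\<beta>\<close>-terms then combine to
      \<open>\<beta> u\<close>, while the others annihilate \<open>J\<close> and are bounded through
      distances to \<open>J\<close>.\<close>
    obtain \<alpha> \<beta> where ab: "- \<psi> = \<alpha> + \<beta>" "\<alpha> \<in> annihilator J"
      and L: "\<And>\<gamma>. \<gamma> \<in> annihilator J \<Longrightarrow> norm (\<gamma> + \<beta>) = norm \<gamma> + norm \<beta>"
      using J unfolding M_ideal_def by metis
    have \<gamma>\<alpha>: "\<gamma> + \<alpha> \<in> annihilator J" and m\<alpha>: "- \<alpha> \<in> annihilator J"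
      using \<gamma> ab(2) by (auto simp: annihilator_def blinfun.add_left blinfun.minus_left)
    have "\<phi> = \<gamma> + (- \<psi>)" by (simp add: \<gamma>_def)
    then have ph: "\<phi> = (\<gamma> + \<alpha>) + \<beta>" by (simp only: ab(1) add.assoc)
    have n\<phi>: "norm \<phi> = norm (\<gamma> + \<alpha>) + norm \<beta>" using L[OF \<gamma>\<alpha>] ph by simp
    have "norm \<psi> = norm (\<alpha> + \<beta>)" using ab(1) by (metis norm_minus_cancel)
    then have n\<psi>: "norm \<psi> = norm \<alpha> + norm \<beta>" using L[OF ab(2)] by simp
    have "1 \<le> \<phi> x + \<psi> (x - u)" using F1 by (simp add: Fab)
    also have "\<psi> (x - u) = - ((- \<psi>) (x - u))" by (simp add: blinfun.minus_left)
    also have "\<phi> x + - ((- \<psi>) (x - u)) = (\<gamma> + \<alpha>) x + (- \<alpha>) (x - u) + \<beta> u"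
      unfolding ph ab(1) by (simp add: blinfun.add_left blinfun.minus_left blinfun.diff_right)
    also have "\<dots> \<le> norm (\<gamma> + \<alpha>) * d + norm \<alpha> * \<epsilon> + norm \<beta> * (d + \<epsilon>)"
    proof (intro add_mono)
      show "(\<gamma> + \<alpha>) x \<le> norm (\<gamma> + \<alpha>) * d"
        using annihilator_le_infdist[OF \<gamma>\<alpha> ne, of x] mult_left_mono[OF d(2) norm_ge_zero] by (rule order_trans)
      show "(- \<alpha>) (x - u) \<le> norm \<alpha> * \<epsilon>"
        using annihilator_le_infdist[OF m\<alpha> ne, of "x - u"] mult_left_mono[OF \<epsilon>(2) norm_ge_zero[of \<alpha>]] by simp
      have "\<beta> u \<le> norm \<beta> * norm u" using norm_blinfun[of \<beta> u] by simp
      also have "\<dots> \<le> norm \<beta> * (d + \<epsilon>)" using u by (rule mult_left_mono) simp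
      finally show "\<beta> u \<le> norm \<beta> * (d + \<epsilon>)" .
    qed
    also have "\<dots> = d * norm \<phi> + \<epsilon> * norm \<psi>" by (simp add: n\<phi> n\<psi> algebra_simps)
    finally have "1 \<le> d * norm \<phi> + \<epsilon> * norm \<psi>" .
    \<comment> \<open>The enlarged radii in \<open>norms\<close> exceed \<open>d\<close> and
      \<open>\<epsilon>\<close> by \<open>\<eta>\<close>, so comparison leaves only zero
      functionals.\<close>
    with norms have "\<eta> * (norm \<phi> + norm \<psi>) \<le> 0" by (simp add: d'_def \<epsilon>'_def algebra_simps)
    then have "norm \<phi> + norm \<psi> \<le> 0" using \<eta> by (simp add: mult_le_0_iff)
    then have "norm \<phi> = 0" "norm \<psi> = 0" using norm_ge_zero[of \<phi>] norm_ge_zero[of \<psi>] by linarith+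
    then show False using \<open>1 \<le> d * norm \<phi> + \<epsilon> * norm \<psi>\<close> by simp
  qed
  then obtain j where "j \<in> J" "norm (x - j) / d' \<le> 1" "norm (x - u - j) / \<epsilon>' \<le> 1" by (auto simp: N_def)
  then show ?thesis using pos by (intro that[of "x - j"]) (auto simp: d'_def \<epsilon>'_def algebra_simps)
qed

text \<open>The excess \<open>\<eta>\<close> is removed by iterating the approximate version with
  halved errors; completeness supplies the limit, and the total displacement is at most the
  geometric sum of \<open>2 * \<epsilon> / 2 ^ n\<close>.\<close>

lemma M_ideal_two_balls_exact:
  fixes J :: "'a::banach set"
  assumes J: "M_ideal J" and d: "0 \<le> d" "infdist x J \<le> d"
    and \<epsilon>: "0 < \<epsilon>" "infdist (x - u) J \<le> \<epsilon>" and u: "norm u \<le> d + \<epsilon>"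
  obtains w where "x - w \<in> J" "norm w \<le> d" "norm (w - u) \<le> 4 * \<epsilon>"
proof -
  have subJ: "subspace J" and clJ: "closed J" using J by (auto simp: M_ideal_def closed_subspace_def)
  \<comment> \<open>\<open>P\<close> keeps the hypotheses of the approximate version valid with
    error \<open>\<epsilon> / 2 ^ n\<close>, and \<open>Q\<close> bounds the displacement obtained
    with \<open>\<eta> = \<epsilon> / 2 ^ Suc n\<close>.\<close>
  define P where "P n v \<longleftrightarrow> infdist (x - v) J \<le> \<epsilon> / 2 ^ n \<and> norm v \<le> d + \<epsilon> / 2 ^ n" for n :: nat and v
  define Q where "Q n v w \<longleftrightarrow> x - w \<in> J \<and> norm (w - v) \<le> 2 * \<epsilon> / 2 ^ n" for n :: nat and v w
  have step: "\<exists>w. P (Suc n) w \<and> Q n v w" if "P n v" for n v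
  proof -
    have "\<epsilon> / 2 ^ Suc n > 0" using \<epsilon> by simp
    then obtain w where w: "x - w \<in> J" "norm w \<le> d + \<epsilon> / 2 ^ Suc n" "norm (w - v) \<le> \<epsilon> / 2 ^ n + \<epsilon> / 2 ^ Suc n"
      using M_ideal_two_balls[OF J d, of "\<epsilon> / 2 ^ n" v "\<epsilon> / 2 ^ Suc n"] \<epsilon> \<open>P n v\<close> unfolding P_def by auto
    moreover have "\<epsilon> / 2 ^ n + \<epsilon> / 2 ^ Suc n \<le> 2 * \<epsilon> / 2 ^ n" using \<epsilon> by (simp add: field_simps)
    ultimately show ?thesis using \<epsilon> by (intro exI[of _ w]) (auto simp: P_def Q_def)
  qed
  obtain f where f: "f 0 = u" "\<And>n. P n (f n)" "\<And>n. Q n (f n) (f (Suc n))"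
  proof -
    have "\<exists>f. (f 0 = u) \<and> (\<forall>n. P n (f n)) \<and> (\<forall>n. Q n (f n) (f (Suc n)))"
    proof -
      have "P 0 u" using \<epsilon> u by (simp add: P_def)
      then have "\<exists>f. \<forall>n. (P n (f n) \<and> (n = 0 \<longrightarrow> f n = u)) \<and> Q n (f n) (f (Suc n))"
        by (intro dependent_nat_choice) (use step in auto)
      then show ?thesis by blast
    qed
    then show ?thesis using that by blast
  qed
  define g where "g n = f (Suc n) - f n" for n
  have gn: "norm (g n) \<le> 2 * \<epsilon> * (1 / 2) ^ n" for n
    using f(3)[of n] by (simp add: g_def Q_def power_divide)
  have sm: "summable (\<lambda>n. 2 * \<epsilon> * (1 / 2 :: real) ^ n)" by (intro summable_mult summable_geometric) simp
  have sg: "summable (\<lambda>n. norm (g n))" by (rule summable_comparison_test'[OF sm]) (use gn in auto)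
  then have "summable g" by (rule summable_norm_cancel)
  then have "(\<lambda>n. \<Sum>i<n. g i) \<longlonglongrightarrow> suminf g" by (simp add: summable_LIMSEQ)
  moreover have "(\<Sum>i<n. g i) = f n - u" for n unfolding g_def by (simp add: sum_lessThan_telescope f(1))
  ultimately have "(\<lambda>n. f n - u + u) \<longlonglongrightarrow> suminf g + u" by (intro tendsto_intros) simp
  then have lim: "f \<longlonglongrightarrow> suminf g + u" by simp
  show ?thesis
  proof
    have "(\<lambda>n. x - f (Suc n)) \<longlonglongrightarrow> x - (suminf g + u)" using LIMSEQ_Suc[OF lim] by (intro tendsto_intros)
    then show "x - (suminf g + u) \<in> J"
      by (rule closed_sequentially[OF clJ, rotated]) (use f(3) in \<open>auto simp: Q_def\<close>)
    have "(\<lambda>n. d + \<epsilon> * (1 / 2) ^ n) \<longlonglongrightarrow> d + \<epsilon> * 0" by (intro tendsto_intros LIMSEQ_realpow_zero) auto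
    moreover have "(\<lambda>n. norm (f n)) \<longlonglongrightarrow> norm (suminf g + u)" by (intro tendsto_intros lim)
    ultimately show "norm (suminf g + u) \<le> d"
      using f(2) LIMSEQ_le[of "\<lambda>n. norm (f n)" _ "\<lambda>n. d + \<epsilon> * (1 / 2) ^ n"] by (auto simp: P_def power_divide)
    have "norm (suminf g) \<le> (\<Sum>n. norm (g n))" by (rule summable_norm[OF sg])
    also have "\<dots> \<le> (\<Sum>n. 2 * \<epsilon> * (1 / 2) ^ n)" by (rule suminf_le[OF gn sg sm])
    also have "\<dots> = 4 * \<epsilon>" by (subst suminf_mult) (auto simp: suminf_geometric intro!: summable_geometric)
    finally show "norm (suminf g + u - u) \<le> 4 * \<epsilon>" by simp
  qed
qed

section \<open>From M-ideals to strong proximinality\<close>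

text \<open>Modulo \<open>J\<close> a subsequence of \<open>y\<close> tends to some \<open>v\<close>
  in \<open>Z\<close>, and \<open>x - v\<close> has distance at most \<open>d\<close> from
  \<open>J\<close>. The exact two ball lemma replaces the residual \<open>x - y (r n)\<close> by a
  nearby element of \<open>x - v + J\<close> of norm at most \<open>d\<close>; subtracting that from
  \<open>x\<close> gives a best approximation.\<close>

lemma M_ideal_minimizing_subsequence:
  fixes Z :: "'a::banach set"
  assumes J: "M_ideal J" "J = pre_annihilator E" "finite E" and JZ: "J \<subseteq> Z" and Z: "closed_subspace Z"
    and y: "range y \<subseteq> Z" "(\<lambda>n. norm (x - y n)) \<longlonglongrightarrow> infdist x Z"
  shows "\<exists>(r::nat \<Rightarrow> nat) z. strict_mono r \<and> range z \<subseteq> best_approx Z x \<and>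
           (\<lambda>k. norm (y (r k) - z k)) \<longlonglongrightarrow> 0"
proof -
  have subJ: "subspace J" using J by (simp add: M_ideal_def closed_subspace_def)
  have subZ: "subspace Z" and clZ: "closed Z" using Z by (auto simp: closed_subspace_def)
  define d where "d = infdist x Z"
  have d0: "d \<ge> 0" by (simp add: d_def infdist_nonneg)
  obtain r v j where r: "strict_mono (r :: nat \<Rightarrow> nat)" and "range j \<subseteq> J"
    and lim: "(\<lambda>n. y (r n) - j n) \<longlonglongrightarrow> v"
    using bounded_subseq_convergent_mod_pre_annihilator[OF J(3) bounded_range_if_norm_tendsto[OF y(2)]] J(2) by metis
  then have j: "j n \<in> J" for n by auto
  have yZ: "y n \<in> Z" for n using y(1) by auto
  have vZ: "v \<in> Z"
    by (rule closed_sequentially[OF clZ _ lim]) (use yZ j JZ subZ in \<open>auto intro: subspace_diff\<close>)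
  define u where "u n = x - y (r n)" for n
  define e where "e n = norm (y (r n) - j n - v)" for n
  have e: "e \<longlonglongrightarrow> 0" unfolding e_def using lim tendsto_norm_zero LIM_zero by blast
  have nu: "(\<lambda>n. norm (u n)) \<longlonglongrightarrow> d"
    using LIMSEQ_subseq_LIMSEQ[OF y(2) r] by (simp add: u_def d_def o_def)
  have dist1: "infdist (x - v) J \<le> norm (u n) + e n" for n
  proof -
    have "infdist (x - v) J \<le> dist (x - v) (j n)" by (rule infdist_le) (rule j)
    also have "\<dots> = norm (u n + (y (r n) - j n - v))" by (simp add: dist_norm u_def algebra_simps)
    also have "\<dots> \<le> norm (u n) + e n" unfolding e_def by (rule norm_triangle_ineq)
    finally show ?thesis .
  qed
  have "(\<lambda>n. norm (u n) + e n) \<longlonglongrightarrow> d + 0" by (intro tendsto_intros nu e)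
  then have distd: "infdist (x - v) J \<le> d" using dist1 LIMSEQ_le_const by fastforce
  have dist2: "infdist (x - v - u n) J \<le> e n" for n
  proof -
    have "infdist (x - v - u n) J \<le> dist (x - v - u n) (j n)" by (rule infdist_le) (rule j)
    also have "\<dots> = e n" by (simp add: dist_norm u_def e_def algebra_simps)
    finally show ?thesis .
  qed
  \<comment> \<open>One error controls both the norm excess and the distance modulo
    \<open>J\<close>; the last summand keeps it strictly positive, as the two ball lemma
    demands.\<close>
  define \<epsilon> where "\<epsilon> n = \<bar>norm (u n) - d\<bar> + e n + 1 / real (Suc n)" for n
  have en: "e n \<ge> 0" for n by (simp add: e_def)
  have \<epsilon>pos: "\<epsilon> n > 0" for n unfolding \<epsilon>_def using en[of n] by (intro add_nonneg_pos) auto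
  have "\<exists>w. x - v - w \<in> J \<and> norm w \<le> d \<and> norm (w - u n) \<le> 4 * \<epsilon> n" for n
  proof -
    have "infdist (x - v - u n) J \<le> \<epsilon> n" "norm (u n) \<le> d + \<epsilon> n"
      using dist2[of n] en[of n] divide_nonneg_nonneg[of 1 "real (Suc n)"] unfolding \<epsilon>_def by linarith+
    then show ?thesis using M_ideal_two_balls_exact[OF J(1) d0 distd \<epsilon>pos] by metis
  qed
  then obtain w where w: "\<And>n. x - v - w n \<in> J" "\<And>n. norm (w n) \<le> d" "\<And>n. norm (w n - u n) \<le> 4 * \<epsilon> n" by metis
  have wZ: "x - w n \<in> Z" for n
  proof -
    have "(x - v - w n) + v \<in> Z" using w(1)[of n] JZ vZ subZ by (intro subspace_add) auto
    then show ?thesis by (simp add: algebra_simps)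
  qed
  have best: "x - w n \<in> best_approx Z x" for n
    using w(2)[of n] wZ[of n] infdist_le[OF wZ[of n], of x] by (simp add: best_approx_def dist_norm d_def)
  have "\<epsilon> \<longlonglongrightarrow> \<bar>d - d\<bar> + 0 + 0" unfolding \<epsilon>_def
    by (intro tendsto_intros nu e LIMSEQ_Suc[OF lim_1_over_n])
  then have "(\<lambda>n. 4 * \<epsilon> n) \<longlonglongrightarrow> 0" using tendsto_mult_right_zero by fastforce
  moreover have "norm (y (r n) - (x - w n)) \<le> 4 * \<epsilon> n" for n
    using w(3)[of n] by (simp add: u_def algebra_simps)
  ultimately have "(\<lambda>n. norm (y (r n) - (x - w n))) \<longlonglongrightarrow> 0"
    by (simp add: tendsto_sandwich[OF _ _ tendsto_const, where h = "\<lambda>n. 4 * \<epsilon> n"])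
  then show ?thesis using r best by (intro exI[of _ r] exI[of _ "\<lambda>n. x - w n"]) auto
qed

lemma infdist_minimizing_sequence:
  assumes "Z \<noteq> {}"
  obtains y :: "nat \<Rightarrow> 'a::metric_space" where "range y \<subseteq> Z" "(\<lambda>n. dist x (y n)) \<longlonglongrightarrow> infdist x Z"
proof -
  have "\<exists>z\<in>Z. dist x z < infdist x Z + 1 / real (Suc n)" for n
  proof (rule ccontr)
    assume "\<not> ?thesis"
    then have "infdist x Z + 1 / real (Suc n) \<le> infdist x Z"
      by (subst (2) infdist_notempty[OF assms]) (auto intro!: cINF_greatest[OF assms])
    then show False by simp
  qed
  then obtain y where y: "\<And>n. y n \<in> Z" "\<And>n. dist x (y n) < infdist x Z + 1 / real (Suc n)" by metis
  have "(\<lambda>n. infdist x Z + 1 / real (Suc n)) \<longlonglongrightarrow> infdist x Z + 0"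
    by (intro tendsto_intros LIMSEQ_Suc[OF lim_1_over_n])
  then have "(\<lambda>n. dist x (y n)) \<longlonglongrightarrow> infdist x Z"
    by (simp add: tendsto_sandwich[OF _ _ tendsto_const, where h = "\<lambda>n. infdist x Z + 1 / real (Suc n)"]
        infdist_le y less_imp_le del: of_nat_Suc)
  then show ?thesis using y(1) that by blast
qed

theorem M_ideal_imp_strongly_proximinal:
  fixes Z :: "'a::banach set"
  assumes J: "M_ideal J" "J = pre_annihilator E" "finite E" and JZ: "J \<subseteq> Z" and Z: "closed_subspace Z"
  shows "strongly_proximinal Z UNIV"
proof -
  have ne: "Z \<noteq> {}" using Z subspace_0 by (auto simp: closed_subspace_def)
  \<comment> \<open>Existence comes from the same lemma: the sequence it produces consists of best
    approximations.\<close>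
  have "best_approx Z x \<noteq> {}" for x
  proof -
    obtain y where "range y \<subseteq> Z" "(\<lambda>n. dist x (y n)) \<longlonglongrightarrow> infdist x Z"
      using infdist_minimizing_sequence[OF ne] by blast
    then show ?thesis using M_ideal_minimizing_subsequence[OF J JZ Z, of y x] by (auto simp: dist_norm)
  qed
  then have "proximinal Z UNIV" using Z by (auto simp: proximinal_def closed_subspace_def)
  then show ?thesis unfolding strongly_proximinal_def
    using M_ideal_minimizing_subsequence[OF J JZ Z] by blast
qed

subsection \<open>Spaces whose dual is an \<open>L\<^sub>1\<close>-space\<close>

lemma pre_annihilator_span: "pre_annihilator (span E) = pre_annihilator E"
proof
  show "pre_annihilator (span E) \<subseteq> pre_annihilator E" using span_superset by (auto simp: pre_annihilator_def)
  have "blinfun_apply \<phi> x = 0" if "x \<in> pre_annihilator E" "\<phi> \<in> span E" for x \<phi>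
    using that(2)
    by (induction rule: span_induct_alt)
       (use that(1) in \<open>auto simp: pre_annihilator_def blinfun.add_left blinfun.scaleR_left\<close>)
  then show "pre_annihilator E \<subseteq> pre_annihilator (span E)" by (auto simp: pre_annihilator_def)
qed

text \<open>\<open>\<Phi>\<close> stands for the inverse isometry composed with the quotient map, so
  that it acts on functions instead of classes. Its values off the integrable functions are left
  open.\<close>

locale L1_dual =
  fixes M :: "'m measure" and \<Phi> :: "('m \<Rightarrow> real) \<Rightarrow> ('x::banach \<Rightarrow>\<^sub>L real)"
  assumes \<Phi>_add: "integrable M f \<Longrightarrow> integrable M g \<Longrightarrow> \<Phi> (\<lambda>t. f t + g t) = \<Phi> f + \<Phi> g"
    and \<Phi>_scale: "integrable M f \<Longrightarrow> \<Phi> (\<lambda>t. c * f t) = c *\<^sub>R \<Phi> f"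
    and norm_\<Phi>: "integrable M f \<Longrightarrow> norm (\<Phi> f) = (LINT t|M. \<bar>f t\<bar>)"
    and \<Phi>_surj: "\<exists>f. integrable M f \<and> \<Phi> f = \<phi>"
begin

lemma integrable_indicator_mult:
  "A \<in> sets M \<Longrightarrow> integrable M f \<Longrightarrow> integrable M (\<lambda>t. indicator A t * f t :: real)"
  using integrable_mult_indicator[of A M f] by simp

lemma \<Phi>_diff:
  assumes "integrable M f" "integrable M g"
  shows "\<Phi> (\<lambda>t. f t - g t) = \<Phi> f - \<Phi> g"
  using \<Phi>_add[OF assms(1), of "\<lambda>t. (- 1) * g t"] \<Phi>_scale[OF assms(2), of "- 1"] assms by simp

lemma \<Phi>_cong:
  assumes "integrable M f" "integrable M g" "\<And>t. t \<in> space M \<Longrightarrow> f t = g t"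
  shows "\<Phi> f = \<Phi> g"
proof -
  have "norm (\<Phi> f - \<Phi> g) = (LINT t|M. \<bar>f t - g t\<bar>)"
    using \<Phi>_diff[OF assms(1,2)] norm_\<Phi>[of "\<lambda>t. f t - g t"] assms(1,2) by simp
  also have "\<dots> = (LINT t|M. 0)" by (rule Bochner_Integration.integral_cong) (use assms(3) in auto)
  finally show ?thesis by simp
qed

section \<open>Bands and their common kernels\<close>

definition band :: "'m set \<Rightarrow> ('x \<Rightarrow>\<^sub>L real) set" where
  "band A = {\<Phi> (\<lambda>t. indicator A t * f t) |f. integrable M f}"

text \<open>The finite sets of the overview, with \<open>band A\<close> for
  \<open>V\<^sub>A\<close>.\<close>

definition finite_band :: "'m set \<Rightarrow> bool" where
  "finite_band A \<longleftrightarrow> A \<in> sets M \<and> (\<exists>E. finite E \<and> band A \<subseteq> span E)"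

lemma bandI: "integrable M f \<Longrightarrow> \<Phi> (\<lambda>t. indicator A t * f t) \<in> band A"
  by (auto simp: band_def)

lemma bandE:
  assumes "\<phi> \<in> band A" "A \<in> sets M"
  obtains f where "integrable M f" "\<phi> = \<Phi> f" "\<And>t. t \<notin> A \<Longrightarrow> f t = 0"
proof -
  obtain f where "integrable M f" "\<phi> = \<Phi> (\<lambda>t. indicator A t * f t)" using assms by (auto simp: band_def)
  then show ?thesis using integrable_indicator_mult[OF assms(2)] by (intro that[of "\<lambda>t. indicator A t * f t"]) auto
qed

lemma bandI':
  assumes "A \<in> sets M" "integrable M f" "\<And>t. t \<in> space M - A \<Longrightarrow> f t = 0"
  shows "\<Phi> f \<in> band A"
proof -
  have "\<Phi> f = \<Phi> (\<lambda>t. indicator A t * f t)"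
    by (rule \<Phi>_cong) (use assms integrable_indicator_mult in \<open>auto simp: indicator_def\<close>)
  then show ?thesis using bandI[OF assms(2)] by simp
qed

lemma band_mono:
  assumes "A \<in> sets M" "B \<in> sets M" "A \<subseteq> B"
  shows "band A \<subseteq> band B"
proof
  fix \<phi> assume "\<phi> \<in> band A"
  then obtain f where f: "integrable M f" "\<phi> = \<Phi> f" "\<And>t. t \<notin> A \<Longrightarrow> f t = 0" using bandE assms by metis
  then show "\<phi> \<in> band B" using bandI'[OF assms(2) f(1)] assms(3) by auto
qed

lemma subspace_band:
  assumes "A \<in> sets M"
  shows "subspace (band A)"
  unfolding subspace_def
proof (intro conjI ballI allI)
  show "0 \<in> band A" using bandI'[OF assms, of "\<lambda>t. 0"] \<Phi>_scale[of "\<lambda>t. 0" 0] by simp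
next
  fix \<phi> \<psi> assume "\<phi> \<in> band A" "\<psi> \<in> band A"
  then obtain f g where f: "integrable M f" "\<phi> = \<Phi> f" "\<And>t. t \<notin> A \<Longrightarrow> f t = 0"
    and g: "integrable M g" "\<psi> = \<Phi> g" "\<And>t. t \<notin> A \<Longrightarrow> g t = 0"
    using bandE[OF _ assms] by metis
  have "\<Phi> (\<lambda>t. f t + g t) \<in> band A" by (rule bandI'[OF assms]) (use f g in auto)
  then show "\<phi> + \<psi> \<in> band A" by (simp add: f g \<Phi>_add)
next
  fix c \<phi> assume "\<phi> \<in> band A"
  then obtain f where f: "integrable M f" "\<phi> = \<Phi> f" "\<And>t. t \<notin> A \<Longrightarrow> f t = 0"
    using bandE[OF _ assms] by metis
  have "\<Phi> (\<lambda>t. c * f t) \<in> band A" by (rule bandI'[OF assms]) (use f in auto)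
  then show "c *\<^sub>R \<phi> \<in> band A" by (simp add: f \<Phi>_scale)
qed

lemma finite_band_basis:
  assumes "finite_band A"
  obtains E where "finite E" "span E = band A"
proof -
  obtain E where A: "A \<in> sets M" and E: "finite E" "band A \<subseteq> span E" using assms by (auto simp: finite_band_def)
  obtain B where B: "B \<subseteq> band A" "independent B" "band A \<subseteq> span B"
    using basis_exists[of "band A"] by metis
  have "finite B" using independent_span_bound[OF E(1) B(2)] B(1) E(2) by auto
  moreover have "span B = band A" using B span_minimal[OF B(1) subspace_band[OF A]] by auto
  ultimately show ?thesis using that by blast
qed

text \<open>A finite dimensional space of functionals equals its double annihilator; this is the
  direction that identifies the annihilator of the common kernel with the band itself.\<close>

lemma annihilator_band:
  assumes "finite_band A"
  shows "annihilator (pre_annihilator (band A)) \<subseteq> band A"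
proof -
  obtain E where "finite E" "span E = band A" using finite_band_basis[OF assms] .
  then show ?thesis using annihilator_pre_annihilator_subset_span pre_annihilator_span by metis
qed

text \<open>Restricting a representing function to \<open>A\<close> and to its complement gives the
  two summands; functions with disjoint supports have additive \<open>L\<^sub>1\<close>
  norms.\<close>

lemma M_ideal_band:
  assumes "finite_band A"
  shows "M_ideal (pre_annihilator (band A))"
  unfolding M_ideal_def
proof (intro conjI allI)
  have A: "A \<in> sets M" using assms by (simp add: finite_band_def)
  fix \<psi>
  obtain f where f: "integrable M f" "\<Phi> f = \<psi>" using \<Phi>_surj by blast
  define f1 where "f1 t = indicator A t * f t" for t
  define f2 where "f2 t = f t - f1 t" for t
  have f1: "integrable M f1" unfolding f1_def[abs_def] by (rule integrable_indicator_mult[OF A f(1)])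
  have f2: "integrable M f2" unfolding f2_def[abs_def] by (rule Bochner_Integration.integrable_diff[OF f(1) f1])
  have "\<psi> = \<Phi> f1 + \<Phi> f2" using \<Phi>_add[OF f1 f2] f(2) by (simp add: f2_def)
  moreover have "\<Phi> f1 \<in> annihilator (pre_annihilator (band A))"
    using bandI[OF f(1), of A] by (auto simp: f1_def[abs_def] annihilator_def pre_annihilator_def)
  moreover have "norm (\<gamma> + \<Phi> f2) = norm \<gamma> + norm (\<Phi> f2)"
    if "\<gamma> \<in> annihilator (pre_annihilator (band A))" for \<gamma>
  proof -
    have "\<gamma> \<in> band A" using annihilator_band[OF assms] that by blast
    then obtain h where h: "integrable M h" "\<gamma> = \<Phi> h" "\<And>t. t \<notin> A \<Longrightarrow> h t = 0" using bandE[OF _ A] by metis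
    have "norm (\<gamma> + \<Phi> f2) = (LINT t|M. \<bar>h t + f2 t\<bar>)"
      using \<Phi>_add[OF h(1) f2] norm_\<Phi>[of "\<lambda>t. h t + f2 t"] h f2 by simp
    also have "\<dots> = (LINT t|M. \<bar>h t\<bar> + \<bar>f2 t\<bar>)"
      by (rule Bochner_Integration.integral_cong) (auto simp: f2_def f1_def h(3) indicator_def)
    also have "\<dots> = norm \<gamma> + norm (\<Phi> f2)" using h f2 by (simp add: norm_\<Phi>)
    finally show ?thesis .
  qed
  ultimately show "\<exists>\<alpha> \<beta>. \<psi> = \<alpha> + \<beta> \<and> \<alpha> \<in> annihilator (pre_annihilator (band A)) \<and>
        (\<forall>\<gamma>\<in>annihilator (pre_annihilator (band A)). norm (\<gamma> + \<beta>) = norm \<gamma> + norm \<beta>)"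
    by (intro exI[of _ "\<Phi> f1"] exI[of _ "\<Phi> f2"]) simp
qed (rule closed_subspace_pre_annihilator)

lemma finite_band_Un:
  assumes "finite_band A" "finite_band B"
  shows "finite_band (A \<union> B)"
proof -
  obtain E F where sets: "A \<in> sets M" "B \<in> sets M" and E: "finite E" "band A \<subseteq> span E"
    and F: "finite F" "band B \<subseteq> span F"
    using assms by (auto simp: finite_band_def)
  have "\<phi> \<in> span (E \<union> F)" if \<phi>: "\<phi> \<in> band (A \<union> B)" for \<phi>
  proof -
    obtain f where f: "integrable M f" "\<phi> = \<Phi> f" "\<And>t. t \<notin> A \<union> B \<Longrightarrow> f t = 0"
      using bandE[OF \<phi> sets.Un[OF sets]] by metis
    define g where "g t = f t - indicator A t * f t" for t
    have g: "integrable M g" unfolding g_def[abs_def]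
      by (intro Bochner_Integration.integrable_diff integrable_indicator_mult f sets)
    have "\<Phi> g \<in> band B" by (rule bandI'[OF sets(2) g]) (use f(3) in \<open>auto simp: g_def indicator_def\<close>)
    moreover have "\<phi> = \<Phi> (\<lambda>t. indicator A t * f t) + \<Phi> g"
      using \<Phi>_add[OF integrable_indicator_mult[OF sets(1) f(1)] g] f(2) by (simp add: g_def)
    moreover have "\<Phi> (\<lambda>t. indicator A t * f t) \<in> band A" by (rule bandI[OF f(1)])
    ultimately show ?thesis
      using E(2) F(2) span_mono[of E "E \<union> F"] span_mono[of F "E \<union> F"] by (auto intro!: span_add)
  qed
  then show ?thesis using sets E(1) F(1) unfolding finite_band_def by (intro conjI exI[of _ "E \<union> F"]) auto
qed

lemma finite_band_empty: "finite_band {}"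
proof -
  have "band {} \<subseteq> {0}" using \<Phi>_scale[of "\<lambda>t. 0" 0] by (auto simp: band_def)
  then show ?thesis unfolding finite_band_def by (intro conjI exI[of _ "{}"]) auto
qed

lemma finite_band_UN:
  assumes "finite I" "\<And>i. i \<in> I \<Longrightarrow> finite_band (A i)"
  shows "finite_band (\<Union>i\<in>I. A i)"
  using assms by (induction I) (auto intro: finite_band_empty finite_band_Un)

section \<open>Atoms, and sets without parts of small mass\<close>

text \<open>On an atom \<open>h\<close> has constant sign almost everywhere: either the part where
  it is positive or the rest of \<open>A\<close> is null.\<close>

lemma abs_integral_indivisible:
  assumes A: "A \<in> sets M" and h: "integrable M h" "\<And>t. t \<notin> A \<Longrightarrow> h t = (0 :: real)"
    and indiv: "\<And>B. B \<in> sets M \<Longrightarrow> B \<subseteq> A \<Longrightarrow> (AE t in M. t \<notin> B) \<or> (AE t in M. t \<notin> A - B)"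
  shows "\<bar>LINT t|M. h t\<bar> = (LINT t|M. \<bar>h t\<bar>)"
proof -
  have nonneg: "0 \<le> (LINT t|M. \<bar>h t\<bar>)" by (rule integral_nonneg_AE) simp
  define B where "B = {t\<in>space M. h t > 0}"
  have [measurable]: "h \<in> borel_measurable M" using h(1) by simp
  have "B \<in> sets M" unfolding B_def by measurable
  moreover have "B \<subseteq> A" using h(2) by (force simp: B_def)
  ultimately consider "AE t in M. t \<notin> B" | "AE t in M. t \<notin> A - B" using indiv by blast
  then show ?thesis
  proof cases
    case 1
    have "AE t in M. \<bar>h t\<bar> = - h t" using 1 AE_space by eventually_elim (simp add: B_def)
    then have "(LINT t|M. \<bar>h t\<bar>) = (LINT t|M. - h t)" by (intro integral_cong_AE) auto
    then show ?thesis using nonneg by simp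
  next
    case 2
    have "AE t in M. \<bar>h t\<bar> = h t" using 2 AE_space
      by eventually_elim (use h(2) in \<open>force simp: B_def\<close>)
    then have "(LINT t|M. \<bar>h t\<bar>) = (LINT t|M. h t)" by (intro integral_cong_AE) auto
    then show ?thesis using nonneg by simp
  qed
qed

text \<open>An atom carries at most a one dimensional band: a function on it with integral zero is
  zero almost everywhere.\<close>

lemma finite_band_indivisible:
  fixes f :: "'m \<Rightarrow> real"
  assumes A: "A \<in> sets M" and f: "integrable M f" "\<And>t. t \<in> A \<Longrightarrow> f t \<noteq> 0"
    and indiv: "\<And>B. B \<in> sets M \<Longrightarrow> B \<subseteq> A \<Longrightarrow>
      (LINT t|M. indicator B t * \<bar>f t\<bar>) = 0 \<or> (LINT t|M. indicator (A - B) t * \<bar>f t\<bar>) = 0"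
  shows "finite_band A"
proof -
  \<comment> \<open>As \<open>f\<close> has no zeros in \<open>A\<close>, mass zero with respect to
    \<open>\<bar>f\<bar>\<close> means null with respect to \<open>M\<close>.\<close>
  have null: "AE t in M. t \<notin> B" if B: "B \<in> sets M" "B \<subseteq> A" "(LINT t|M. indicator B t * \<bar>f t\<bar>) = 0" for B
  proof -
    have "AE t in M. indicator B t * \<bar>f t\<bar> = 0"
      using integral_nonneg_eq_0_iff_AE[of M "\<lambda>t. indicator B t * \<bar>f t\<bar>"]
        integrable_indicator_mult[OF B(1), of "\<lambda>t. \<bar>f t\<bar>"] f(1) B(3) by simp
    then show ?thesis by eventually_elim (use B(2) f(2) in \<open>auto simp: indicator_def split: if_splits\<close>)
  qed
  have indiv': "(AE t in M. t \<notin> B) \<or> (AE t in M. t \<notin> A - B)" if "B \<in> sets M" "B \<subseteq> A" for B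
    using indiv[OF that] null[of B] null[of "A - B"] that A by blast
  define fA where "fA t = indicator A t * f t" for t
  have fA: "integrable M fA" using integrable_indicator_mult[OF A f(1)] by (simp add: fA_def[abs_def])
  have fA0: "fA t = 0" if "t \<notin> A" for t using that by (simp add: fA_def)
  have abs: "\<bar>LINT t|M. fA t\<bar> = (LINT t|M. \<bar>fA t\<bar>)" by (rule abs_integral_indivisible[OF A fA fA0 indiv'])
  have "\<phi> \<in> span {\<Phi> fA}" if \<phi>: "\<phi> \<in> band A" for \<phi>
  proof -
    obtain g where g: "integrable M g" "\<phi> = \<Phi> g" "\<And>t. t \<notin> A \<Longrightarrow> g t = 0" 
      using bandE[OF \<phi> A] by metis
    show ?thesis
    proof (cases "(LINT t|M. fA t) = 0")
      case True
      then have "AE t in M. \<bar>fA t\<bar> = 0"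
        using integral_nonneg_eq_0_iff_AE[of M "\<lambda>t. \<bar>fA t\<bar>"] abs fA by simp
      then have "AE t in M. g t = 0" by eventually_elim (use f(2) g(3) in \<open>force simp: fA_def indicator_def\<close>)
      then have "(LINT t|M. \<bar>g t\<bar>) = (LINT t|M. 0)" using g(1) by (intro integral_cong_AE) auto
      then have "\<phi> = 0" using norm_\<Phi>[OF g(1)] g(2) by simp
      then show ?thesis by (simp add: span_zero)
    next
      case False
      \<comment> \<open>This quotient makes the integral of \<open>g t - c * fA t\<close> vanish,
        and on an atom the absolute integral vanishes with it.\<close>
      define c where "c = (LINT t|M. g t) / (LINT t|M. fA t)"
      have k: "integrable M (\<lambda>t. g t - c * fA t)" using g fA by simp
      have "norm (\<Phi> (\<lambda>t. g t - c * fA t)) = \<bar>LINT t|M. g t - c * fA t\<bar>"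
        unfolding norm_\<Phi>[OF k] by (rule abs_integral_indivisible[OF A k _ indiv', symmetric]) (simp_all add: g(3) fA0)
      also have "\<dots> = 0" using g(1) fA False by (simp add: c_def)
      finally have "\<phi> = c *\<^sub>R \<Phi> fA" using \<Phi>_diff[OF g(1), of "\<lambda>t. c * fA t"] \<Phi>_scale[OF fA] fA g(2) by simp
      then show ?thesis by (simp add: span_base span_scale)
    qed
  qed
  then show ?thesis using A unfolding finite_band_def by (intro conjI exI[of _ "{\<Phi> fA}"]) auto
qed

text \<open>A set that is not an atom splits into two parts of positive mass, each at least
  \<open>\<delta>\<close>, so each part has lost at least \<open>\<delta>\<close>. As the total mass
  is finite, the splitting ends after boundedly many rounds, which the induction on \<open>n\<close>
  counts.\<close>

lemma finite_band_no_small_sets: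
  fixes f :: "'m \<Rightarrow> real"
  assumes "A \<in> sets M" and f: "integrable M f" "\<And>t. t \<in> A \<Longrightarrow> f t \<noteq> 0" and \<delta>: "\<delta> > 0"
    and "\<And>B. B \<in> sets M \<Longrightarrow> B \<subseteq> A \<Longrightarrow>
      (LINT t|M. indicator B t * \<bar>f t\<bar>) = 0 \<or> (LINT t|M. indicator B t * \<bar>f t\<bar>) \<ge> \<delta>"
  shows "finite_band A"
proof -
  define I where "I B = (LINT t|M. indicator B t * \<bar>f t\<bar>)" for B
  have "finite_band A" if "I A < real n * \<delta>" "A \<in> sets M" "\<And>t. t \<in> A \<Longrightarrow> f t \<noteq> 0"
    "\<And>B. B \<in> sets M \<Longrightarrow> B \<subseteq> A \<Longrightarrow> I B = 0 \<or> I B \<ge> \<delta>" for n A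
    using that
  proof (induction n arbitrary: A)
    case 0
    have "I A \<ge> 0" unfolding I_def by (rule integral_nonneg_AE) simp
    with 0 show ?case by simp
  next
    case (Suc n)
    show ?case
    proof (cases "\<forall>B\<in>sets M. B \<subseteq> A \<longrightarrow> I B = 0 \<or> I (A - B) = 0")
      case True
      then show ?thesis using Suc.prems f unfolding I_def by (intro finite_band_indivisible[of A f]) auto
    next
      case False
      then obtain B where B: "B \<in> sets M" "B \<subseteq> A" "I B \<noteq> 0" "I (A - B) \<noteq> 0" by blast
      have ge: "I B \<ge> \<delta>" "I (A - B) \<ge> \<delta>" using Suc.prems(4)[of B] Suc.prems(4)[of "A - B"] B Suc.prems(2) by auto
      have "I A = (LINT t|M. indicator B t * \<bar>f t\<bar> + indicator (A - B) t * \<bar>f t\<bar>)"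
        unfolding I_def by (rule Bochner_Integration.integral_cong) (use B(2) in \<open>auto simp: indicator_def\<close>)
      also have "\<dots> = I B + I (A - B)"
        unfolding I_def using f(1) B(1) Suc.prems(2)
        by (intro Bochner_Integration.integral_add integrable_indicator_mult) auto
      finally have "I A = I B + I (A - B)" .
      then have lt: "I B < real n * \<delta>" "I (A - B) < real n * \<delta>" using ge Suc.prems(1) by (auto simp: algebra_simps)
      have dich: "I C = 0 \<or> I C \<ge> \<delta>" if "C \<in> sets M" "C \<subseteq> B \<or> C \<subseteq> A - B" for C
        using Suc.prems(4)[of C] that B(2) by blast
      have "finite_band B" by (rule Suc.IH[OF lt(1) B(1)]) (use B(2) Suc.prems(3) dich in auto)
      moreover have "finite_band (A - B)"
        by (rule Suc.IH[OF lt(2)]) (use B(1) Suc.prems(2,3) dich in auto)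
      moreover have "A = B \<union> (A - B)" using B(2) by auto
      ultimately show ?thesis using finite_band_Un by metis
    qed
  qed
  moreover obtain n where "I A < real n * \<delta>" using reals_Archimedean3[OF \<delta>] by blast
  ultimately show ?thesis using assms unfolding I_def by blast
qed

section \<open>Sign flips and functionals carried by finite sets\<close>

text \<open>If \<open>\<psi> = \<Phi> f\<close> and \<open>A\<close> carries a small positive part \<open>c\<close> of \<open>\<bar>f\<bar>\<close>, flipping the sign of \<open>f\<close> on \<open>A\<close>
  does not change the norm on \<open>Y\<close>. A nearly norming vector of the flipped functional is nearly
  norming for \<open>\<psi>\<close>, but the part of \<open>\<psi>\<close> carried by \<open>A\<close> is about \<open>-c\<close> there and \<open>c\<close> on the face.\<close>

lemma near_face_imp_no_small_sets:
  fixes f :: "'m \<Rightarrow> real" and Y :: "'x set"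
  assumes Y: "subspace Y" and A0: "A0 \<in> sets M" "annihilator Y \<subseteq> band A0"
    and f: "integrable M f" "norm (\<Phi> f) \<le> 1"
    and sup: "\<And>k. k < 1 \<Longrightarrow> \<exists>y\<in>Y. norm y \<le> 1 \<and> \<Phi> f y > k"
    and near: "\<And>w. w \<in> Y \<Longrightarrow> norm w \<le> 1 \<Longrightarrow> \<Phi> f w > 1 - \<delta> \<Longrightarrow>
      \<exists>v\<in>Y. norm v \<le> 1 \<and> \<Phi> f v = 1 \<and> norm (w - v) < 1 / 2"
    and A: "A \<in> sets M" "A \<inter> A0 = {}"
  shows "(LINT t|M. indicator A t * \<bar>f t\<bar>) = 0 \<or> (LINT t|M. indicator A t * \<bar>f t\<bar>) \<ge> \<delta> / 4"
proof (rule ccontr)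
  define c where "c = (LINT t|M. indicator A t * \<bar>f t\<bar>)"
  assume "\<not> ?thesis"
  moreover have "c \<ge> 0" unfolding c_def by (rule integral_nonneg_AE) simp
  ultimately have c: "0 < c" "c < \<delta> / 4" unfolding c_def by linarith+
  define fA where "fA t = indicator A t * f t" for t
  define fB where "fB t = f t - fA t" for t
  have fA: "integrable M fA" using integrable_indicator_mult[OF A(1) f(1)] by (simp add: fA_def[abs_def])
  have fB: "integrable M fB" using f(1) fA by (simp add: fB_def[abs_def])
  have sum: "\<Phi> f = \<Phi> fA + \<Phi> fB" using \<Phi>_add[OF fA fB] by (simp add: fB_def)
  have nA: "norm (\<Phi> fA) = c" unfolding norm_\<Phi>[OF fA] c_def fA_def by (simp add: abs_mult)
  have "norm (\<Phi> f) = (LINT t|M. \<bar>fA t\<bar> + \<bar>fB t\<bar>)"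
    unfolding norm_\<Phi>[OF f(1)]
    by (rule Bochner_Integration.integral_cong) (auto simp: fB_def fA_def indicator_def)
  also have "\<dots> = norm (\<Phi> fA) + norm (\<Phi> fB)" using fA fB by (simp add: norm_\<Phi>)
  finally have nB: "norm (\<Phi> fB) \<le> 1 - c" using nA f(2) by simp
  then have c1: "c \<le> 1" using norm_ge_zero[of "\<Phi> fB"] by linarith
  define \<psi> where "\<psi> = \<Phi> fB - \<Phi> fA"
  have "\<exists>w\<in>Y. norm w \<le> 1 \<and> \<psi> w > 1 - c / 2"
  proof (rule ccontr)
    assume "\<not> ?thesis"
    then have le: "\<psi> w \<le> 1 - c / 2" if "w \<in> Y" "norm w \<le> 1" for w using that by force
    have "\<psi> y \<le> (1 - c / 2) * norm y" if "y \<in> Y" for y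
    proof (cases "y = 0")
      case False
      have "\<psi> ((1 / norm y) *\<^sub>R y) \<le> 1 - c / 2" using that False Y by (intro le) (auto simp: subspace_scale)
      then show ?thesis using False by (simp add: blinfun.scaleR_right field_simps)
    qed (simp add: blinfun.zero_right)
    then obtain \<theta> :: "'x \<Rightarrow>\<^sub>L real" where \<theta>: "norm \<theta> \<le> 1 - c / 2" "\<And>y. y \<in> Y \<Longrightarrow> \<theta> y = \<psi> y"
      using hahn_banach_restriction[OF Y, of "1 - c / 2" \<psi>] c1 by auto
    \<comment> \<open>A norm-reducing extension \<open>\<theta>\<close> can differ from the flipped
      functional only by some \<open>h\<close> carried by \<open>A0\<close>, which is disjoint from
      \<open>A\<close>.\<close>
    have "\<theta> - \<psi> \<in> annihilator Y" using \<theta>(2) by (simp add: annihilator_def blinfun.diff_left)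
    then obtain h where h: "integrable M h" "\<theta> - \<psi> = \<Phi> h" "\<And>t. t \<notin> A0 \<Longrightarrow> h t = 0"
      using bandE[OF _ A0(1)] A0(2) by blast
    have I: "integrable M (\<lambda>t. f t + h t)" "integrable M (\<lambda>t. fB t - fA t + h t)" using f(1) h(1) fA fB by auto
    have "\<theta> = \<psi> + \<Phi> h" using h(2) by (metis add.commute diff_add_cancel)
    also have "\<psi> = \<Phi> (\<lambda>t. fB t - fA t)" by (simp only: \<psi>_def \<Phi>_diff[OF fB fA])
    also have "\<Phi> (\<lambda>t. fB t - fA t) + \<Phi> h = \<Phi> (\<lambda>t. fB t - fA t + h t)"
      by (rule \<Phi>_add[symmetric]) (use fA fB h(1) in auto)
    finally have "norm \<theta> = (LINT t|M. \<bar>fB t - fA t + h t\<bar>)" using norm_\<Phi>[OF I(2)] by simp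
    \<comment> \<open>Since \<open>h\<close> vanishes on \<open>A\<close>, the flip can be undone
      without changing the absolute value. The result agrees with \<open>\<Phi> f\<close> on
      \<open>Y\<close> but has too small a norm, against \<open>sup\<close>.\<close>
    also have "\<dots> = (LINT t|M. \<bar>f t + h t\<bar>)"
    proof (rule Bochner_Integration.integral_cong)
      fix t
      show "\<bar>fB t - fA t + h t\<bar> = \<bar>f t + h t\<bar>"
        using A(2) h(3)[of t] by (cases "t \<in> A") (auto simp: fB_def fA_def disjoint_iff)
    qed simp
    also have "\<dots> = norm (\<Phi> f + \<Phi> h)" using norm_\<Phi>[OF I(1)] \<Phi>_add[OF f(1) h(1)] by simp
    finally have n: "norm (\<Phi> f + \<Phi> h) \<le> 1 - c / 2" using \<theta>(1) by simp
    obtain y where y: "y \<in> Y" "norm y \<le> 1" "\<Phi> f y > 1 - c / 2" using sup[of "1 - c / 2"] c by auto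
    have "\<Phi> f y = (\<Phi> f + \<Phi> h) y" using h(2) \<theta>(2)[OF y(1)] by (simp add: blinfun.add_left flip: h(2)) (simp add: blinfun.diff_left)
    also have "\<dots> \<le> norm (\<Phi> f + \<Phi> h) * norm y" using norm_blinfun[of "\<Phi> f + \<Phi> h" y] by simp
    also have "\<dots> \<le> (1 - c / 2) * 1" using n y(2) c1 by (intro mult_mono) auto
    finally show False using y(3) by simp
  qed
  then obtain w where w: "w \<in> Y" "norm w \<le> 1" "\<psi> w > 1 - c / 2" by blast
  have bound: "\<bar>\<phi> u\<bar> \<le> r" if "norm \<phi> \<le> r" "norm u \<le> 1" for \<phi> :: "'x \<Rightarrow>\<^sub>L real" and u r
  proof -
    have "\<bar>\<phi> u\<bar> \<le> norm \<phi> * norm u" using norm_blinfun[of \<phi> u] by simp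
    also have "\<dots> \<le> r * 1" using that order_trans[OF norm_ge_zero that(1)] by (intro mult_mono) auto
    finally show ?thesis by simp
  qed
  have \<psi>w: "\<psi> w = \<Phi> fB w - \<Phi> fA w" by (simp add: \<psi>_def blinfun.diff_left)
  have fw: "\<Phi> f u = \<Phi> fA u + \<Phi> fB u" for u by (simp add: sum blinfun.add_left)
  \<comment> \<open>Undoing the flip costs at most \<open>2 * c\<close>, so the value exceeds
    \<open>1 - 5 / 2 * c\<close>; \<open>c < \<delta> / 4\<close> suffices.\<close>
  have "\<Phi> f w > 1 - \<delta>"
    using w(3) \<psi>w fw[of w] bound[OF eq_refl[OF nA] w(2)] c by linarith
  then obtain v where v: "v \<in> Y" "norm v \<le> 1" "\<Phi> f v = 1" "norm (w - v) < 1 / 2" using near w by blast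
  \<comment> \<open>\<open>\<Phi> fB\<close> contributes at most \<open>1 - c\<close> at either
    point. So \<open>\<Phi> fA\<close> is at least \<open>c\<close> at \<open>v\<close> and below
    \<open>- c / 2\<close> at \<open>w\<close>, a gap too large for a functional of norm
    \<open>c\<close> and points closer than \<open>1 / 2\<close>.\<close>
  have "\<Phi> fA v \<ge> c" using v(3) fw[of v] bound[OF nB v(2)] by linarith
  moreover have "\<Phi> fA w < - c + c / 2" using w(3) \<psi>w bound[OF nB w(2)] by linarith
  ultimately have "\<bar>\<Phi> fA (w - v)\<bar> > 3 / 2 * c" unfolding blinfun.diff_right by linarith
  moreover have "\<bar>\<Phi> fA (w - v)\<bar> \<le> c * (1 / 2)"
  proof -
    have "\<bar>\<Phi> fA (w - v)\<bar> \<le> c * norm (w - v)" using norm_blinfun[of "\<Phi> fA" "w - v"] nA by simp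
    also have "\<dots> \<le> c * (1 / 2)" using v(4) c(1) by (intro mult_left_mono) auto
    finally show ?thesis .
  qed
  ultimately show False using c(1) by simp
qed

text \<open>The sign flip argument reaches only sets disjoint from \<open>A0\<close>. It shows that
  the support of \<open>f\<close> outside \<open>A0\<close> has no small parts, and
  \<open>A0\<close> is finite by hypothesis.\<close>

lemma near_face_imp_finite_band:
  fixes Y :: "'x set" and \<psi> :: "'x \<Rightarrow>\<^sub>L real"
  assumes Y: "subspace Y" and A0: "finite_band A0" "annihilator Y \<subseteq> band A0"
    and \<psi>: "norm \<psi> \<le> 1" and sup: "\<And>k. k < 1 \<Longrightarrow> \<exists>y\<in>Y. norm y \<le> 1 \<and> \<psi> y > k"
    and \<delta>: "\<delta> > 0" and near: "\<And>w. w \<in> Y \<Longrightarrow> norm w \<le> 1 \<Longrightarrow> \<psi> w > 1 - \<delta> \<Longrightarrow>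
      \<exists>v\<in>Y. norm v \<le> 1 \<and> \<psi> v = 1 \<and> norm (w - v) < 1 / 2"
  shows "\<exists>B. finite_band B \<and> \<psi> \<in> band B"
proof -
  obtain f where f: "integrable M f" "\<Phi> f = \<psi>" using \<Phi>_surj by blast
  have A0': "A0 \<in> sets M" using A0(1) by (simp add: finite_band_def)
  define S where "S = {t\<in>space M. f t \<noteq> 0} - A0"
  have [measurable]: "f \<in> borel_measurable M" using f(1) by simp
  have S: "S \<in> sets M" unfolding S_def using A0' by measurable
  have "finite_band S"
  proof (rule finite_band_no_small_sets[OF S f(1)])
    fix B assume B: "B \<in> sets M" "B \<subseteq> S"
    then have "B \<inter> A0 = {}" by (auto simp: S_def)
    with near_face_imp_no_small_sets[OF Y A0' A0(2) f(1) _ _ _ B(1), of \<delta>] \<psi> sup near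
    show "(LINT t|M. indicator B t * \<bar>f t\<bar>) = 0 \<or> \<delta> / 4 \<le> (LINT t|M. indicator B t * \<bar>f t\<bar>)"
      unfolding f(2) by blast
  qed (use \<delta> in \<open>auto simp: S_def\<close>)
  then have fin: "finite_band (A0 \<union> S)" by (rule finite_band_Un[OF A0(1)])
  have "\<Phi> f \<in> band (A0 \<union> S)" by (rule bandI') (use A0' S f(1) in \<open>auto simp: S_def\<close>)
  then show ?thesis using fin f(2) by blast
qed

text \<open>\<open>\<phi>\<close> is exchanged for an extension \<open>\<psi>\<close> of its
  restriction to \<open>Y\<close> with norm at most \<open>c\<close>, the norm of that restriction.
  The difference annihilates \<open>Y\<close>, so it lies in \<open>band A0\<close>; the normalized
  \<open>\<psi>\<close> is handled by the near-face property.\<close>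

lemma strongly_proximinal_annihilator_finite_band:
  fixes Y Z :: "'x set"
  assumes A0: "finite_band A0" "annihilator Y \<subseteq> band A0"
    and sp: "strongly_proximinal Z Y" and fc: "finite_codim Z" and \<phi>: "\<phi> \<in> annihilator Z"
  shows "\<exists>B. finite_band B \<and> \<phi> \<in> band B"
proof -
  have Y: "subspace Y" and ZY: "Z \<subseteq> Y"
    using sp by (auto simp: strongly_proximinal_def proximinal_def closed_subspace_def)
  define S where "S = {\<phi> y |y. y \<in> Y \<and> norm y \<le> 1}"
  define c where "c = Sup S"
  have "\<phi> y \<le> norm \<phi>" if "norm y \<le> 1" for y
  proof -
    have "\<phi> y \<le> norm \<phi> * norm y" using norm_blinfun[of \<phi> y] by simp
    also have "\<dots> \<le> norm \<phi>" using that by (simp add: mult_left_le)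
    finally show ?thesis .
  qed
  then have bdd: "bdd_above S" by (auto simp: S_def intro!: bdd_aboveI[of _ "norm \<phi>"])
  have "0 \<in> S" using subspace_0[OF Y] by (force simp: S_def blinfun.zero_right)
  then have c0: "c \<ge> 0" and ne: "S \<noteq> {}" using cSup_upper[OF _ bdd] by (auto simp: c_def)
  have le: "\<phi> y \<le> c * norm y" if "y \<in> Y" for y
  proof (cases "y = 0")
    case False
    have "(1 / norm y) *\<^sub>R y \<in> Y" "norm ((1 / norm y) *\<^sub>R y) \<le> 1" using that Y False by (auto simp: subspace_scale)
    then have "\<phi> ((1 / norm y) *\<^sub>R y) \<in> S" unfolding S_def by blast
    then have "\<phi> ((1 / norm y) *\<^sub>R y) \<le> c" using cSup_upper[OF _ bdd] by (simp add: c_def)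
    then show ?thesis using False by (simp add: blinfun.scaleR_right field_simps)
  qed (simp add: blinfun.zero_right)
  obtain \<psi> :: "'x \<Rightarrow>\<^sub>L real" where \<psi>: "norm \<psi> \<le> c" "\<And>y. y \<in> Y \<Longrightarrow> \<psi> y = \<phi> y"
    using hahn_banach_restriction[OF Y c0 le] by blast
  have diff: "\<phi> - \<psi> \<in> band A0" using A0(2) \<psi>(2) by (auto simp: annihilator_def blinfun.diff_left)
  show ?thesis
  proof (cases "c = 0")
    case True
    \<comment> \<open>Here \<open>\<psi> = 0\<close>, so \<open>\<phi>\<close> itself lies in
      \<open>band A0\<close>.\<close>
    then show ?thesis using \<psi>(1) diff A0(1) by auto
  next
    case False
    with c0 have c: "c > 0" by simp
    define \<theta> where "\<theta> = (1 / c) *\<^sub>R \<psi>"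
    have \<theta>1: "norm \<theta> \<le> 1" using \<psi>(1) c by (simp add: \<theta>_def)
    have \<theta>y: "\<theta> y = \<phi> y / c" if "y \<in> Y" for y using \<psi>(2)[OF that] by (simp add: \<theta>_def blinfun.scaleR_left)
    have "\<theta> \<in> annihilator Z" using \<phi> ZY \<theta>y by (auto simp: annihilator_def)
    moreover have "\<theta> y \<le> norm y" if "y \<in> Y" for y using le[OF that] c by (simp add: \<theta>y[OF that] pos_divide_le_eq mult.commute)
    ultimately obtain \<delta> where \<delta>: "\<delta> > 0" "\<And>w. w \<in> Y \<Longrightarrow> norm w \<le> 1 \<Longrightarrow> \<theta> w > 1 - \<delta> \<Longrightarrow>
      \<exists>v\<in>Y. norm v \<le> 1 \<and> \<theta> v = 1 \<and> norm (w - v) < 1 / 2"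
      using strongly_proximinal_near_face[OF sp fc, of \<theta> "1 / 2"] by auto
    have sup: "\<exists>y\<in>Y. norm y \<le> 1 \<and> \<theta> y > k" if "k < 1" for k
    proof -
      have "c * k < Sup S" using that c by (simp add: c_def[symmetric])
      then obtain s where "s \<in> S" "c * k < s" using less_cSupD[OF ne] by blast
      then obtain y where "y \<in> Y" "norm y \<le> 1" "\<phi> y > c * k" by (auto simp: S_def)
      then show ?thesis using c by (intro bexI[of _ y]) (simp_all add: \<theta>y pos_less_divide_eq mult.commute)
    qed
    obtain B where B: "finite_band B" "\<theta> \<in> band B"
      using near_face_imp_finite_band[OF Y A0 \<theta>1 sup \<delta>] by blast
    have sets: "A0 \<in> sets M" "B \<in> sets M" using A0(1) B(1) by (auto simp: finite_band_def)
    then have sub: "band A0 \<subseteq> band (A0 \<union> B)" "band B \<subseteq> band (A0 \<union> B)" "subspace (band (A0 \<union> B))"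
      by (simp_all add: band_mono subspace_band)
    then have "(\<phi> - \<psi>) + c *\<^sub>R \<theta> \<in> band (A0 \<union> B)"
      using diff B(2) by (intro subspace_add subspace_scale) auto
    then have "\<phi> \<in> band (A0 \<union> B)" using c by (simp add: \<theta>_def)
    then show ?thesis using finite_band_Un[OF A0(1) B(1)] by blast
  qed
qed

section \<open>The characterization by finite sets and its two consequences\<close>

lemma strongly_proximinal_imp_finite_band:
  fixes Y Z :: "'x set"
  assumes A0: "finite_band A0" "pre_annihilator (band A0) \<subseteq> Y"
    and sp: "strongly_proximinal Z Y" and fc: "finite_codim Z"
  shows "\<exists>A. finite_band A \<and> pre_annihilator (band A) \<subseteq> Z"
proof -
  have "closed_subspace Z" using sp by (auto simp: strongly_proximinal_def proximinal_def)
  then obtain F where F: "finite F" "Z = pre_annihilator F" using finite_codim_pre_annihilator fc by metis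
  \<comment> \<open>Annihilators reverse the inclusion, and the double annihilator of the finite
    band is contained in it.\<close>
  have "annihilator Y \<subseteq> band A0" using annihilator_band[OF A0(1)] A0(2) by (auto simp: annihilator_def)
  then have "\<exists>B. finite_band B \<and> \<phi> \<in> band B" if "\<phi> \<in> F" for \<phi>
    using that F by (intro strongly_proximinal_annihilator_finite_band[OF A0(1) _ sp fc])
      (auto simp: annihilator_def pre_annihilator_def)
  then obtain B where B: "\<And>\<phi>. \<phi> \<in> F \<Longrightarrow> finite_band (B \<phi>) \<and> \<phi> \<in> band (B \<phi>)" by metis
  have fin: "finite_band (\<Union>\<phi>\<in>F. B \<phi>)" using F(1) B by (intro finite_band_UN) auto
  have "band (B \<phi>) \<subseteq> band (\<Union>\<phi>\<in>F. B \<phi>)" if "\<phi> \<in> F" for \<phi>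
    using B[OF that] fin that by (intro band_mono) (auto simp: finite_band_def)
  then have "F \<subseteq> band (\<Union>\<phi>\<in>F. B \<phi>)" using B by blast
  then have "pre_annihilator (band (\<Union>\<phi>\<in>F. B \<phi>)) \<subseteq> Z" by (auto simp: F(2) pre_annihilator_def)
  then show ?thesis using fin by blast
qed

lemma strongly_proximinal_UNIV_imp_finite_band:
  fixes Y :: "'x set"
  assumes "strongly_proximinal Y UNIV" "finite_codim Y"
  shows "\<exists>A. finite_band A \<and> pre_annihilator (band A) \<subseteq> Y"
  using strongly_proximinal_imp_finite_band[OF finite_band_empty _ assms] by simp

lemma finite_band_imp_strongly_proximinal:
  fixes Z :: "'x set"
  assumes "finite_band A" "pre_annihilator (band A) \<subseteq> Z" "closed_subspace Z"
  shows "strongly_proximinal Z UNIV"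
proof -
  obtain E where "finite E" "span E = band A" using finite_band_basis[OF assms(1)] .
  then show ?thesis
    using M_ideal_imp_strongly_proximinal[OF M_ideal_band[OF assms(1)] _ _ assms(2,3)] pre_annihilator_span by metis
qed

lemma strongly_proximinal_trans:
  fixes Y Z :: "'x set"
  assumes "strongly_proximinal Y UNIV" "finite_codim Y" "strongly_proximinal Z Y" "finite_codim Z"
  shows "strongly_proximinal Z UNIV"
proof -
  obtain A where "finite_band A" "pre_annihilator (band A) \<subseteq> Y"
    using strongly_proximinal_UNIV_imp_finite_band[OF assms(1,2)] by blast
  then obtain B where "finite_band B" "pre_annihilator (band B) \<subseteq> Z"
    using strongly_proximinal_imp_finite_band[OF _ _ assms(3,4)] by blast
  moreover have "closed_subspace Z" using assms(3) by (auto simp: strongly_proximinal_def proximinal_def)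
  ultimately show ?thesis by (rule finite_band_imp_strongly_proximinal)
qed

lemma strongly_proximinal_Inter:
  fixes \<F> :: "'x set set"
  assumes fin: "finite \<F>" and \<F>: "\<And>Y. Y \<in> \<F> \<Longrightarrow> strongly_proximinal Y UNIV" "\<And>Y. Y \<in> \<F> \<Longrightarrow> finite_codim Y"
  shows "strongly_proximinal (\<Inter>\<F>) UNIV"
proof -
  have "\<exists>A. finite_band A \<and> pre_annihilator (band A) \<subseteq> Y" if "Y \<in> \<F>" for Y
    using \<F>[OF that] by (rule strongly_proximinal_UNIV_imp_finite_band)
  then obtain A where A: "\<And>Y. Y \<in> \<F> \<Longrightarrow> finite_band (A Y) \<and> pre_annihilator (band (A Y)) \<subseteq> Y" by metis
  have un: "finite_band (\<Union>Y\<in>\<F>. A Y)" using fin A by (intro finite_band_UN) auto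
  have "band (A Y) \<subseteq> band (\<Union>Y\<in>\<F>. A Y)" if "Y \<in> \<F>" for Y
    using A[OF that] un that by (intro band_mono) (auto simp: finite_band_def)
  then have "pre_annihilator (band (\<Union>Y\<in>\<F>. A Y)) \<subseteq> Y" if "Y \<in> \<F>" for Y
    using A[OF that] that unfolding pre_annihilator_def by blast
  then have "pre_annihilator (band (\<Union>Y\<in>\<F>. A Y)) \<subseteq> \<Inter>\<F>" by blast
  moreover have "closed_subspace Y" if "Y \<in> \<F>" for Y
    using \<F>(1)[OF that] by (auto simp: strongly_proximinal_def proximinal_def)
  then have "closed_subspace (\<Inter>\<F>)" by (auto simp: closed_subspace_def intro: subspace_Inter)
  ultimately show ?thesis by (rule finite_band_imp_strongly_proximinal[OF un])
qed

end

section \<open>From the isometry onto classes to the map on functions\<close>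

lemma L1_predual_imp_L1_dual:
  fixes M :: "'m measure"
  assumes "L1_predual TYPE('x::banach) M"
  obtains \<Phi> :: "('m \<Rightarrow> real) \<Rightarrow> ('x::banach \<Rightarrow>\<^sub>L real)" where "L1_dual M \<Phi>"
proof -
  obtain T :: "('x \<Rightarrow>\<^sub>L real) \<Rightarrow> ('m \<Rightarrow> real) set" where bij: "bij_betw T UNIV (L1_space M)"
    and T: "\<forall>\<phi> \<psi>. \<forall>f\<in>T \<phi>. \<forall>g\<in>T \<psi>. (\<lambda>t. f t + g t) \<in> T (\<phi> + \<psi>)"
      "\<forall>c \<phi>. \<forall>f\<in>T \<phi>. (\<lambda>t. c * f t) \<in> T (c *\<^sub>R \<phi>)"
      "\<forall>\<phi>. \<forall>f\<in>T \<phi>. norm \<phi> = (LINT t|M. \<bar>f t\<bar>)"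
    using assms unfolding L1_predual_def by (elim exE conjE) (rule that)
  have add: "(\<lambda>t. f t + g t) \<in> T (\<phi> + \<psi>)" if "f \<in> T \<phi>" "g \<in> T \<psi>" for \<phi> \<psi> f g
    using T(1) that by blast
  have scale: "(\<lambda>t. c * f t) \<in> T (c *\<^sub>R \<phi>)" if "f \<in> T \<phi>" for c \<phi> f using T(2) that by blast
  have nrm: "norm \<phi> = (LINT t|M. \<bar>f t\<bar>)" if "f \<in> T \<phi>" for \<phi> f using T(3) that by blast
  \<comment> \<open>The difference of two representatives, both chosen as \<open>f\<close>, is the
    zero function and computes the norm of \<open>\<phi> - \<psi>\<close>.\<close>
  have inj: "\<phi> = \<psi>" if "f \<in> T \<phi>" "f \<in> T \<psi>" for \<phi> \<psi> f
    using nrm[OF add[OF that(1) scale[OF that(2), of "- 1"]]] by simp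
  have ex: "\<exists>\<phi>. f \<in> T \<phi>" if "integrable M f" for f
  proof -
    have "ae_eq_rel M `` {f} \<in> L1_space M" unfolding L1_space_def using that by (intro quotientI) simp
    then obtain \<phi> where "T \<phi> = ae_eq_rel M `` {f}" using bij by (metis bij_betw_imp_surj_on imageE)
    then show ?thesis using that by (intro exI[of _ \<phi>]) (simp add: ae_eq_rel_def)
  qed
  \<comment> \<open>For integrable \<open>f\<close> the choice is unique by \<open>inj\<close>; each
    identity for \<open>\<Phi>\<close> follows by exhibiting one function in two classes.\<close>
  define \<Phi> where "\<Phi> f = (SOME \<phi>. f \<in> T \<phi>)" for f
  have mem: "f \<in> T (\<Phi> f)" if "integrable M f" for f unfolding \<Phi>_def by (rule someI_ex[OF ex[OF that]])
  have "L1_dual M \<Phi>"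
  proof
    show "\<Phi> (\<lambda>t. f t + g t) = \<Phi> f + \<Phi> g" if "integrable M f" "integrable M g" for f g
      using inj[OF mem add[OF mem mem]] that by simp
    show "\<Phi> (\<lambda>t. c * f t) = c *\<^sub>R \<Phi> f" if "integrable M f" for c f
      using inj[OF mem scale[OF mem]] that by simp
    show "norm (\<Phi> f) = (LINT t|M. \<bar>f t\<bar>)" if "integrable M f" for f using nrm[OF mem[OF that]] .
    show "\<exists>f. integrable M f \<and> \<Phi> f = \<phi>" for \<phi>
    proof -
      have "T \<phi> \<in> L1_space M" using bij by (auto simp: bij_betw_def)
      then obtain f where f: "integrable M f" "T \<phi> = ae_eq_rel M `` {f}"
        unfolding L1_space_def by (auto elim: quotientE)
      then have "f \<in> T \<phi>" by (simp add: ae_eq_rel_def)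
      then show ?thesis using f(1) inj[OF mem[OF f(1)]] by blast
    qed
  qed
  then show ?thesis using that by blast
qed

theorem corollary2p19:
  fixes M :: "'m measure"
  assumes "L1_predual TYPE('x::banach) M"
  shows "(\<forall>Y Z :: 'x set.
            closed_subspace Y \<and> closed_subspace Z \<and> Z \<subseteq> Y \<and>
            finite_codim Y \<and> finite_codim Z \<and>
            strongly_proximinal Y UNIV \<and> strongly_proximinal Z Y \<longrightarrow>
            strongly_proximinal Z UNIV) \<and>
         (\<forall>\<F> :: 'x set set.
            finite \<F> \<and> (\<forall>Y\<in>\<F>. finite_codim Y \<and> strongly_proximinal Y UNIV) \<longrightarrow>
            strongly_proximinal (\<Inter>\<F>) UNIV)"
proof -
  obtain \<Phi> :: "('m \<Rightarrow> real) \<Rightarrow> ('x \<Rightarrow>\<^sub>L real)" where "L1_dual M \<Phi>"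
    using L1_predual_imp_L1_dual[OF assms] .
  then interpret L1_dual M \<Phi> .
  show ?thesis using strongly_proximinal_trans strongly_proximinal_Inter by blast
qed

end
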